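(* Let $\mathcal I$ be the set of all $1$-homogeneous monotone functionals $F:\mathcal X\to[0,\infty]$ which are lower semicontinuous in the box topology, and let $\mathcal A$ be the set of all subsets of $\mathcal X$ that are downward-closed (in the Lipschitz order) and closed in the box topology. For each $A\in\mathcal A$ set $$F_A(X)=\inf\{t>0\mid X\in tA\},\qquad X\in\mathcal X.$$ Then $F_A\in\mathcal I$ for every $A\in\mathcal A$. Moreover, the correspondence $\mathcal A\ni A\mapsto F_A\in\mathcal I$ is bijective.
   Context: A pm-space is a triple $X=(X,d_X,m_X)$ with $(X,d_X)$ a complete separable metric space and $m_X$ a Borel probability measure. Two pm-spaces are isomorphic if there is an isometry $\operatorname{supp} m_X\to\operatorname{supp} m_Y$ pushing $m_X$ forward to $m_Y$; $\mathcal X$ is the set of isomorphism classes, and a class is always represented by a space with $\operatorname{supp}m_X=X$. Lipschitz order: $Y\prec X$ iff there is a $1$-Lipschitz map $\phi:X\to Y$ with $\phi_\#m_X=m_Y$; $A\subset\mathcal X$ is downward-closed if $X\in A$ and $Y\prec X$ imply $Y\in A$. Box distance: a parameter of $X$ is a Borel map $a:[0,1]\to X$ with $a_\#\mathcal L^1=m_X$; $\square(X,Y)$ is the infimum of $\epsilon>0$ such that there are parameters $a$ of $X$, $b$ of $Y$ and a Borel set $I_0\subset[0,1]$ with $\mathcal L^1(I_0)\ge1-\epsilon$ and $|d_X(a(s),a(t))-d_Y(b(s),b(t))|\le\epsilon$ for all $s,t\in I_0$; it induces the box topology on $\mathcal X$. For $t>0$: $tX=(X,td_X,m_X)$ and $tA=\{tX\mid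 X\in A\}$. $F:\mathcal X\to[0,\infty]$ is monotone if $X\prec Y$ implies $F(X)\le F(Y)$, and $1$-homogeneous if $F(tX)=tF(X)$ for all $t>0$, $X\in\mathcal X$. Convention: $\inf\emptyset=\infty$. *)

theory Defs
  imports "HOL-Probability.Probability"
begin

record 'a pm =
  pm_metric :: "'a metric"
  pm_measure :: "'a measure"

abbreviation pm_carrier :: "'a pm \<Rightarrow> 'a set" where
  "pm_carrier x \<equiv> mspace (pm_metric x)"

abbreviation pm_dist :: "'a pm \<Rightarrow> 'a \<Rightarrow> 'a \<Rightarrow> real" where
  "pm_dist x \<equiv> mdist (pm_metric x)"

definition pm_space :: "'a pm \<Rightarrow> bool" where
  "pm_space x \<longleftrightarrow>
     mcomplete_of (pm_metric x) \<and> separable_space (mtopology_of (pm_metric x)) \<and>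
     prob_space (pm_measure x) \<and>
     sets (pm_measure x) =
       sets (sigma (pm_carrier x) {U. openin (mtopology_of (pm_metric x)) U})"

definition pm_supp :: "'a pm \<Rightarrow> 'a set" where
  "pm_supp x = {p \<in> pm_carrier x.
     \<forall>U. openin (mtopology_of (pm_metric x)) U \<and> p \<in> U \<longrightarrow> emeasure (pm_measure x) U > 0}"

text \<open>Isometries are onto. (Given the other clauses this is no restriction: the image of the
  support is complete, hence closed, and of full measure.)\<close>

definition pm_iso :: "'a pm \<Rightarrow> 'b pm \<Rightarrow> bool" where
  "pm_iso x y \<longleftrightarrow>
     (\<exists>f. bij_betw f (pm_supp x) (pm_supp y) \<and>
          (\<forall>p\<in>pm_supp x. \<forall>q\<in>pm_supp x. pm_dist y (f p) (f q) = pm_dist x p q) \<and>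
          f \<in> restrict_space (pm_measure x) (pm_supp x) \<rightarrow>\<^sub>M pm_measure y \<and>
          distr (restrict_space (pm_measure x) (pm_supp x)) (pm_measure y) f = pm_measure y)"

definition full_pm_space :: "'a pm \<Rightarrow> bool" where
  "full_pm_space x \<longleftrightarrow> pm_space x \<and> pm_supp x = pm_carrier x"


subsection \<open>Basic facts\<close>

lemma pm_space_sets:
  assumes "pm_space x"
  shows "sets (pm_measure x) = sigma_sets (pm_carrier x) {U. openin (mtopology_of (pm_metric x)) U}"
    and "space (pm_measure x) = pm_carrier x"
proof -
  have sub: "{U. openin (mtopology_of (pm_metric x)) U} \<subseteq> Pow (pm_carrier x)"
    using openin_subset by fastforce
  have eq: "sets (pm_measure x) = sets (sigma (pm_carrier x) {U. openin (mtopology_of (pm_metric x)) U})"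
    using assms by (simp add: pm_space_def)
  show "sets (pm_measure x) = sigma_sets (pm_carrier x) {U. openin (mtopology_of (pm_metric x)) U}"
    unfolding eq using sub by simp
  show "space (pm_measure x) = pm_carrier x"
    using sets_eq_imp_space_eq[OF eq] sub by (simp add: space_measure_of_conv)
qed

lemma pm_open_sets:
  "pm_space x \<Longrightarrow> openin (mtopology_of (pm_metric x)) U \<Longrightarrow> U \<in> sets (pm_measure x)"
  by (auto simp: pm_space_sets(1))

lemma openin_mtopology_of:
  "openin (mtopology_of m) U \<longleftrightarrow>
     U \<subseteq> mspace m \<and> (\<forall>p\<in>U. \<exists>r>0. \<forall>q\<in>mspace m. mdist m p q < r \<longrightarrow> q \<in> U)"
proof -
  interpret Metric_space "mspace m" "mdist m" by simp
  have "mball p r \<subseteq> U \<longleftrightarrow> (\<forall>q\<in>mspace m. mdist m p q < r \<longrightarrow> q \<in> U)"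
    if "U \<subseteq> mspace m" "p \<in> U" for p r
    using that by (auto simp: subset_iff)
  then show ?thesis
    unfolding mtopology_of_def openin_mtopology Ball_def[of U] by (intro conj_cong refl) simp
qed

lemma openin_mball_of: "openin (mtopology_of m) (mball_of m p r)"
proof -
  interpret Metric_space "mspace m" "mdist m" by simp
  show ?thesis unfolding mtopology_of_def mball_of_def by simp
qed

lemma closedin_pm_supp: "closedin (mtopology_of (pm_metric x)) (pm_supp x)"
proof -
  let ?T = "mtopology_of (pm_metric x)"
  have "pm_carrier x - pm_supp x = \<Union>{U. openin ?T U \<and> emeasure (pm_measure x) U = 0}"
    using openin_subset by (fastforce simp: pm_supp_def)
  then have "openin ?T (pm_carrier x - pm_supp x)"
    by (auto intro: openin_Union)
  then show ?thesis
    by (auto simp: closedin_def pm_supp_def)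
qed

lemma pm_supp_subset: "pm_supp x \<subseteq> pm_carrier x"
  by (auto simp: pm_supp_def)

lemma pm_supp_sets:
  assumes "pm_space x"
  shows "pm_supp x \<in> sets (pm_measure x)"
proof -
  have "pm_carrier x - pm_supp x \<in> sets (pm_measure x)"
    using closedin_pm_supp[of x] assms pm_open_sets by (auto simp: closedin_def)
  then have "space (pm_measure x) - (pm_carrier x - pm_supp x) \<in> sets (pm_measure x)"
    by blast
  then show ?thesis
    using pm_supp_subset[of x] by (simp add: pm_space_sets[OF assms] double_diff)
qed

lemma separable_metric_dense:
  assumes "separable_space (mtopology_of m)"
  obtains C where "countable C" "C \<subseteq> mspace m"
    "\<And>p r. p \<in> mspace m \<Longrightarrow> r > 0 \<Longrightarrow> \<exists>c\<in>C. mdist m p c < r"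
proof -
  interpret Metric_space "mspace m" "mdist m" by simp
  obtain C where C: "countable C" "C \<subseteq> mspace m" "mtopology_of m closure_of C = mspace m"
    using assms by (auto simp: separable_space_def)
  have "\<exists>c\<in>C. mdist m p c < r" if "p \<in> mspace m" "r > 0" for p r
  proof -
    have "p \<in> mtopology closure_of C"
      using C that by (simp add: mtopology_of_def)
    then show ?thesis
      unfolding metric_closure_of using that by auto
  qed
  with C that show ?thesis by blast
qed

lemma pm_space_dense:
  assumes "pm_space x"
  obtains C where "countable C" "C \<subseteq> pm_carrier x"
    "\<And>p r. p \<in> pm_carrier x \<Longrightarrow> r > 0 \<Longrightarrow> \<exists>c\<in>C. pm_dist x p c < r"
proof -
  have "separable_space (mtopology_of (pm_metric x))"
    using assms by (simp add: pm_space_def)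
  then show ?thesis by (rule separable_metric_dense) (rule that)
qed

lemma dense_mball:
  assumes C: "\<And>p r. p \<in> mspace m \<Longrightarrow> r > 0 \<Longrightarrow> \<exists>c\<in>C. mdist m p c < r" "C \<subseteq> mspace m"
    and U: "openin (mtopology_of m) U" "p \<in> U"
  obtains c n where "c \<in> C" "p \<in> mball_of m c (1 / real (Suc n))"
    "mball_of m c (1 / real (Suc n)) \<subseteq> U"
proof -
  interpret Metric_space "mspace m" "mdist m" by simp
  obtain r where r: "r > 0" "\<And>q. q \<in> mspace m \<Longrightarrow> mdist m p q < r \<Longrightarrow> q \<in> U"
    using U unfolding openin_mtopology_of by blast
  have p: "p \<in> mspace m" using U openin_subset by fastforce
  obtain n where n: "1 / real (Suc n) < r / 2"
    using r(1) by (metis half_gt_zero nat_approx_posE)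
  obtain c where c: "c \<in> C" "mdist m p c < 1 / real (Suc n)"
    using C(1)[OF p, of "1 / real (Suc n)"] by auto
  have "q \<in> U" if "q \<in> mspace m" "mdist m c q < 1 / real (Suc n)" for q
  proof -
    have "mdist m p q \<le> mdist m p c + mdist m c q"
      using p c that C(2) by (intro triangle) auto
    then show ?thesis using r that n c by auto
  qed
  then have "mball_of m c (1 / real (Suc n)) \<subseteq> U" by (auto simp del: of_nat_Suc)
  moreover have "p \<in> mball_of m c (1 / real (Suc n))"
    using c p C(2) mdist_commute[of m c p] by auto
  ultimately show ?thesis using that c(1) by blast
qed

lemma AE_pm_supp:
  assumes x: "pm_space x"
  shows "AE p in pm_measure x. p \<in> pm_supp x"
proof -
  let ?m = "pm_metric x" and ?M = "pm_measure x"
  interpret prob_space ?M using x by (simp add: pm_space_def)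
  obtain C where C: "countable C" "C \<subseteq> mspace ?m"
    "\<And>p r. p \<in> mspace ?m \<Longrightarrow> r > 0 \<Longrightarrow> \<exists>c\<in>C. mdist ?m p c < r"
    by (rule pm_space_dense[OF x]) (rule that)
  define b where "b = (\<lambda>(c, n :: nat). mball_of ?m c (1 / real (Suc n)))"
  define I where "I = {i \<in> C \<times> UNIV. emeasure ?M (b i) = 0}"
  define N where "N = (\<Union>i\<in>I. b i)"
  have "countable I"
    by (rule countable_subset[of _ "C \<times> UNIV"]) (auto simp: I_def C(1))
  moreover have "b i \<in> null_sets ?M" if "i \<in> I" for i
  proof (rule null_setsI)
    show "emeasure ?M (b i) = 0" using that by (simp add: I_def)
    show "b i \<in> sets ?M"
      unfolding b_def split_beta by (rule pm_open_sets[OF x openin_mball_of])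
  qed
  ultimately have "N \<in> null_sets ?M"
    unfolding N_def by (rule null_sets_UN')
  then have ae: "AE p in ?M. p \<notin> N" by (rule AE_not_in)
  have sub: "pm_carrier x - pm_supp x \<subseteq> N"
  proof
    fix p assume "p \<in> pm_carrier x - pm_supp x"
    then obtain U where U: "openin (mtopology_of ?m) U" "p \<in> U" "emeasure ?M U = 0"
      by (auto simp: pm_supp_def)
    obtain c n where cn: "c \<in> C" "p \<in> b (c, n)" "b (c, n) \<subseteq> U"
      unfolding b_def prod.case by (rule dense_mball[OF C(3,2) U(1,2)])
    have "emeasure ?M (b (c, n)) = 0"
      using emeasure_mono[OF cn(3) pm_open_sets[OF x U(1)]] U(3) by simp
    then have "(c, n) \<in> I" using cn(1) by (simp add: I_def)
    then show "p \<in> N" using cn(2) unfolding N_def by blast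
  qed
  have "AE p in ?M. p \<notin> N \<longrightarrow> p \<in> pm_supp x"
    using sub by (intro AE_I2) (auto simp: pm_space_sets(2)[OF x])
  with ae show ?thesis by (rule AE_mp)
qed

lemma emeasure_pm_supp:
  assumes x: "pm_space x"
  shows "emeasure (pm_measure x) (pm_supp x) = 1"
proof -
  interpret prob_space "pm_measure x" using x by (simp add: pm_space_def)
  show ?thesis
    by (rule emeasure_eq_1_AE[OF pm_supp_sets[OF x] AE_pm_supp[OF x]])
qed

lemma emeasure_Int_supp:
  assumes x: "pm_space x" and B: "B \<in> sets (pm_measure x)"
  shows "emeasure (pm_measure x) (B \<inter> pm_supp x) = emeasure (pm_measure x) B"
proof -
  have "AE p in pm_measure x. p \<in> B \<inter> pm_supp x \<longleftrightarrow> p \<in> B"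
    using AE_pm_supp[OF x] by eventually_elim simp
  then show ?thesis
    by (rule emeasure_eq_AE) (use B pm_supp_sets[OF x] in \<open>simp_all only: sets.Int\<close>)
qed

lemma emeasure_push_restrict:
  assumes S: "S \<in> sets M" and f: "f \<in> restrict_space M S \<rightarrow>\<^sub>M N" and B: "B \<in> sets N"
  shows "f -` B \<inter> S \<in> sets M"
    and "emeasure (distr (restrict_space M S) N f) B = emeasure M (f -` B \<inter> S)"
proof -
  have sp: "space (restrict_space M S) = S"
    using S sets.sets_into_space by (auto simp: space_restrict_space)
  have "f -` B \<inter> S \<in> sets (restrict_space M S)"
    using measurable_sets[OF f B] by (simp add: sp)
  then show "f -` B \<inter> S \<in> sets M"
    using S by (simp add: sets_restrict_space_iff)
  show "emeasure (distr (restrict_space M S) N f) B = emeasure M (f -` B \<inter> S)"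
    using S f B by (simp add: emeasure_distr sp emeasure_restrict_space)
qed

lemma isometric_measurable:
  assumes x: "pm_space x" and y: "pm_space y" and S: "S \<in> sets (pm_measure x)"
    and f: "f ` S \<subseteq> pm_carrier y"
    and iso: "\<And>p q. p \<in> S \<Longrightarrow> q \<in> S \<Longrightarrow> pm_dist y (f p) (f q) = pm_dist x p q"
  shows "f \<in> restrict_space (pm_measure x) S \<rightarrow>\<^sub>M pm_measure y"
proof (rule measurable_sigma_sets[OF pm_space_sets(1)[OF y]])
  have SC: "S \<subseteq> pm_carrier x" using S sets.sets_into_space pm_space_sets(2)[OF x] by blast
  have sp: "space (restrict_space (pm_measure x) S) = S"
    using SC by (auto simp: space_restrict_space pm_space_sets[OF x])
  show "{U. openin (mtopology_of (pm_metric y)) U} \<subseteq> Pow (pm_carrier y)"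
    using openin_subset by fastforce
  show "f \<in> space (restrict_space (pm_measure x) S) \<rightarrow> pm_carrier y"
    using f sp by auto
  fix U assume "U \<in> {U. openin (mtopology_of (pm_metric y)) U}"
  then have U: "openin (mtopology_of (pm_metric y)) U" by simp
  define V where "V = \<Union>{mball_of (pm_metric x) p r | p r. p \<in> S \<and>
      (\<forall>q\<in>pm_carrier y. pm_dist y (f p) q < r \<longrightarrow> q \<in> U)}"
  have "openin (mtopology_of (pm_metric x)) V"
    unfolding V_def using openin_mball_of by (intro openin_Union) auto
  moreover have "f -` U \<inter> S = V \<inter> S"
  proof (intro equalityI subsetI)
    fix p assume p: "p \<in> f -` U \<inter> S"
    then obtain r where "r > 0" "\<forall>q\<in>pm_carrier y. pm_dist y (f p) q < r \<longrightarrow> q \<in> U"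
      using U unfolding openin_mtopology_of by blast
    moreover from this have "p \<in> mball_of (pm_metric x) p r"
      using p SC mdist_zero[of p "pm_metric x" p] by (simp add: subset_iff del: mdist_zero)
    ultimately show "p \<in> V \<inter> S" using p unfolding V_def by blast
  next
    fix q assume q: "q \<in> V \<inter> S"
    then obtain p r where "q \<in> mball_of (pm_metric x) p r" "p \<in> S"
      "\<forall>q\<in>pm_carrier y. pm_dist y (f p) q < r \<longrightarrow> q \<in> U"
      unfolding V_def by blast
    then show "q \<in> f -` U \<inter> S" using q f iso by auto
  qed
  ultimately show "f -` U \<inter> space (restrict_space (pm_measure x) S)
      \<in> sets (restrict_space (pm_measure x) S)"
    using S pm_open_sets[OF x] by (auto simp: sp sets_restrict_space_iff)
qed

lemma pm_isoI:
  assumes x: "pm_space x" and y: "pm_space y" and f: "bij_betw f (pm_supp x) (pm_supp y)"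
    and d: "\<And>p q. p \<in> pm_supp x \<Longrightarrow> q \<in> pm_supp x \<Longrightarrow> pm_dist y (f p) (f q) = pm_dist x p q"
    and e: "\<And>B. B \<in> sets (pm_measure y) \<Longrightarrow>
              emeasure (pm_measure x) (f -` B \<inter> pm_supp x) = emeasure (pm_measure y) B"
  shows "pm_iso x y"
proof -
  have "f ` pm_supp x \<subseteq> pm_carrier y"
    using f pm_supp_subset[of y] by (auto simp: bij_betw_def)
  then have m: "f \<in> restrict_space (pm_measure x) (pm_supp x) \<rightarrow>\<^sub>M pm_measure y"
    using d by (intro isometric_measurable x y pm_supp_sets)
  have "distr (restrict_space (pm_measure x) (pm_supp x)) (pm_measure y) f = pm_measure y"
    using emeasure_push_restrict[OF pm_supp_sets[OF x] m] e by (intro measure_eqI) auto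
  with m f d show ?thesis unfolding pm_iso_def by blast
qed

lemma pm_isoE:
  assumes "pm_iso x y" and x: "pm_space x"
  obtains f where "bij_betw f (pm_supp x) (pm_supp y)"
    "\<And>p q. p \<in> pm_supp x \<Longrightarrow> q \<in> pm_supp x \<Longrightarrow> pm_dist y (f p) (f q) = pm_dist x p q"
    "\<And>B. B \<in> sets (pm_measure y) \<Longrightarrow> f -` B \<inter> pm_supp x \<in> sets (pm_measure x)"
    "\<And>B. B \<in> sets (pm_measure y) \<Longrightarrow>
       emeasure (pm_measure x) (f -` B \<inter> pm_supp x) = emeasure (pm_measure y) B"
proof -
  obtain f where f: "bij_betw f (pm_supp x) (pm_supp y)"
    "\<forall>p\<in>pm_supp x. \<forall>q\<in>pm_supp x. pm_dist y (f p) (f q) = pm_dist x p q"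
    and m: "f \<in> restrict_space (pm_measure x) (pm_supp x) \<rightarrow>\<^sub>M pm_measure y"
    and e: "distr (restrict_space (pm_measure x) (pm_supp x)) (pm_measure y) f = pm_measure y"
    using assms unfolding pm_iso_def by blast
  show ?thesis
    by (rule that[of f])
      (use f e emeasure_push_restrict[OF pm_supp_sets[OF x] m] in auto)
qed

lemma pm_iso_refl: "pm_space x \<Longrightarrow> pm_iso x x"
  by (rule pm_isoI[where f = "\<lambda>p. p"]) (auto simp: bij_betw_def emeasure_Int_supp)

lemma pm_iso_sym:
  assumes x: "pm_space x" and y: "pm_space y" and "pm_iso x y"
  shows "pm_iso y x"
proof -
  obtain f where b: "bij_betw f (pm_supp x) (pm_supp y)"
    and d: "\<And>p q. p \<in> pm_supp x \<Longrightarrow> q \<in> pm_supp x \<Longrightarrow> pm_dist y (f p) (f q) = pm_dist x p q"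
    and e: "\<And>B. B \<in> sets (pm_measure y) \<Longrightarrow>
       emeasure (pm_measure x) (f -` B \<inter> pm_supp x) = emeasure (pm_measure y) B"
    using pm_isoE[OF assms(3) x] by metis
  define g where "g = inv_into (pm_supp x) f"
  have bg: "bij_betw g (pm_supp y) (pm_supp x)"
    unfolding g_def by (rule bij_betw_inv_into[OF b])
  have fg: "f (g q) = q" if "q \<in> pm_supp y" for q
    unfolding g_def using that b by (simp add: bij_betw_inv_into_right)
  have gf: "g (f p) = p" if "p \<in> pm_supp x" for p
    unfolding g_def using that b by (simp add: bij_betw_inv_into_left)
  have gS: "g q \<in> pm_supp x" if "q \<in> pm_supp y" for q
    using that bg by (auto simp: bij_betw_def)
  have dg: "pm_dist x (g p) (g q) = pm_dist y p q" if "p \<in> pm_supp y" "q \<in> pm_supp y" for p q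
    using d[of "g p" "g q"] that by (simp add: fg gS)
  have mg: "g \<in> restrict_space (pm_measure y) (pm_supp y) \<rightarrow>\<^sub>M pm_measure x"
    using dg gS pm_supp_subset[of x]
    by (intro isometric_measurable x y pm_supp_sets) auto
  show ?thesis
  proof (rule pm_isoI[OF y x bg dg])
    fix B assume B: "B \<in> sets (pm_measure x)"
    have "emeasure (pm_measure y) (g -` B \<inter> pm_supp y)
        = emeasure (pm_measure x) (f -` (g -` B \<inter> pm_supp y) \<inter> pm_supp x)"
      using e[OF emeasure_push_restrict(1)[OF pm_supp_sets[OF y] mg B]] by simp
    also have "f -` (g -` B \<inter> pm_supp y) \<inter> pm_supp x = B \<inter> pm_supp x"
      using b gf by (auto simp: bij_betw_def)
    finally show "emeasure (pm_measure y) (g -` B \<inter> pm_supp y) = emeasure (pm_measure x) B"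
      using emeasure_Int_supp[OF x B] by simp
  qed auto
qed

lemma pm_iso_trans:
  assumes x: "pm_space x" and y: "pm_space y" and z: "pm_space z"
    and "pm_iso x y" "pm_iso y z"
  shows "pm_iso x z"
proof -
  obtain f where f: "bij_betw f (pm_supp x) (pm_supp y)"
    "\<And>p q. p \<in> pm_supp x \<Longrightarrow> q \<in> pm_supp x \<Longrightarrow> pm_dist y (f p) (f q) = pm_dist x p q"
    "\<And>B. B \<in> sets (pm_measure y) \<Longrightarrow>
       emeasure (pm_measure x) (f -` B \<inter> pm_supp x) = emeasure (pm_measure y) B"
    using pm_isoE[OF assms(4) x] by metis
  obtain g where g: "bij_betw g (pm_supp y) (pm_supp z)"
    "\<And>p q. p \<in> pm_supp y \<Longrightarrow> q \<in> pm_supp y \<Longrightarrow> pm_dist z (g p) (g q) = pm_dist y p q"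
    "\<And>B. B \<in> sets (pm_measure z) \<Longrightarrow> g -` B \<inter> pm_supp y \<in> sets (pm_measure y)"
    "\<And>B. B \<in> sets (pm_measure z) \<Longrightarrow>
       emeasure (pm_measure y) (g -` B \<inter> pm_supp y) = emeasure (pm_measure z) B"
    using pm_isoE[OF assms(5) y] by metis
  have fS: "f p \<in> pm_supp y" if "p \<in> pm_supp x" for p
    using that f(1) by (auto simp: bij_betw_def)
  show ?thesis
  proof (rule pm_isoI[OF x z bij_betw_trans[OF f(1) g(1)]])
    fix B assume B: "B \<in> sets (pm_measure z)"
    have "(g \<circ> f) -` B \<inter> pm_supp x = f -` (g -` B \<inter> pm_supp y) \<inter> pm_supp x"
      using fS by auto
    then show "emeasure (pm_measure x) ((g \<circ> f) -` B \<inter> pm_supp x) = emeasure (pm_measure z) B"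
      using f(3)[OF g(3)[OF B]] g(4)[OF B] by simp
  qed (use f g fS in auto)
qed

text \<open>The support of a pm-space can be transported along any injection.\<close>

lemma pm_transport:
  fixes x :: "'a pm" and g :: "'a \<Rightarrow> 'b"
  assumes x: "pm_space x" and inj: "inj_on g (pm_supp x)"
  obtains y :: "'b pm" where "full_pm_space y" "pm_iso x y" "pm_carrier y = g ` pm_supp x"
proof -
  let ?S = "pm_supp x"
  define h where "h = inv_into ?S g"
  have hg: "h (g p) = p" if "p \<in> ?S" for p
    unfolding h_def using inj that by simp
  have hS: "h u \<in> ?S" if "u \<in> g ` ?S" for u
    using that hg by auto
  interpret X: Metric_space "pm_carrier x" "pm_dist x" by simp
  interpret S: Submetric "pm_carrier x" "pm_dist x" ?S
    by unfold_locales (rule pm_supp_subset)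
  define D where "D = (\<lambda>u v. pm_dist x (h u) (h v))"
  interpret Y: Metric_space "g ` ?S" D
  proof
    fix u v w
    show "0 \<le> D u v" "D u v = D v u" by (auto simp: D_def X.commute)
    show "(D u v = 0) = (u = v)" if "u \<in> g ` ?S" "v \<in> g ` ?S"
      using that pm_supp_subset[of x] hg by (auto simp: D_def subset_iff)
    show "D u w \<le> D u v + D v w" if "u \<in> g ` ?S" "v \<in> g ` ?S" "w \<in> g ` ?S"
      using that pm_supp_subset[of x] hS unfolding D_def by (intro X.triangle) auto
  qed
  define m where "m = metric (g ` ?S, D)"
  have m [simp]: "mspace m = g ` ?S" "mdist m = D" "mtopology_of m = Y.mtopology"
    by (simp_all add: m_def)
  define N where "N = distr (restrict_space (pm_measure x) ?S)
      (sigma (g ` ?S) {U. openin Y.mtopology U}) g"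
  define y :: "'b pm" where "y = \<lparr>pm_metric = m, pm_measure = N\<rparr>"
  have y [simp]: "pm_metric y = m" "pm_measure y = N" by (simp_all add: y_def)
  have spS: "space (restrict_space (pm_measure x) ?S) = ?S"
    using pm_supp_subset[of x] by (auto simp: space_restrict_space pm_space_sets[OF x])
  have dgg: "D (g p) (g q) = pm_dist x p q" if "p \<in> ?S" "q \<in> ?S" for p q
    using that by (simp add: D_def hg)
  have sub: "{U. openin Y.mtopology U} \<subseteq> Pow (g ` ?S)"
    using openin_subset by fastforce
  have homeo: "homeomorphic_map S.sub.mtopology Y.mtopology g"
    by (rule Metric_space12.isometry_imp_homeomorphic_map)
      (auto simp: Metric_space12_def dgg S.sub.Metric_space_axioms Y.Metric_space_axioms)
  have preim: "\<exists>V. openin (mtopology_of (pm_metric x)) V \<and> g -` U \<inter> ?S = V \<inter> ?S"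
    if "openin Y.mtopology U" for U
  proof -
    have "openin S.sub.mtopology {p \<in> topspace S.sub.mtopology. g p \<in> U}"
      using homeo that by (intro openin_continuous_map_preimage) (auto simp: homeomorphic_map_def quotient_imp_continuous_map)
    then show ?thesis
      unfolding S.mtopology_submetric openin_subtopology mtopology_of_def
      using pm_supp_subset[of x] by auto
  qed
  have gm: "g \<in> restrict_space (pm_measure x) ?S \<rightarrow>\<^sub>M sigma (g ` ?S) {U. openin Y.mtopology U}"
  proof (rule measurable_measure_of[OF sub])
    fix U assume "U \<in> {U. openin Y.mtopology U}"
    with preim obtain V where "openin (mtopology_of (pm_metric x)) V" "g -` U \<inter> ?S = V \<inter> ?S"
      by blast
    then show "g -` U \<inter> space (restrict_space (pm_measure x) ?S)
        \<in> sets (restrict_space (pm_measure x) ?S)"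
      using pm_open_sets[OF x] pm_supp_sets[OF x] by (auto simp: spS sets_restrict_space_iff)
  qed (auto simp: spS)
  have eN: "emeasure N B = emeasure (pm_measure x) (g -` B \<inter> ?S)" if "B \<in> sets N" for B
    using emeasure_push_restrict(2)[OF pm_supp_sets[OF x] gm] that by (simp add: N_def)
  have compl: "mcomplete_of m"
  proof -
    have clo: "closedin X.mtopology ?S"
      using closedin_pm_supp[of x] by (simp add: mtopology_of_def)
    have comp: "X.mcomplete"
      using x by (simp add: pm_space_def mcomplete_of_def)
    have "Y.mcomplete"
      unfolding Y.mcomplete_def
    proof (intro allI impI)
      fix s assume s: "Y.MCauchy s"
      then have rs: "s n \<in> g ` ?S" for n by (auto simp: Y.MCauchy_def)
      have "S.sub.MCauchy (h \<circ> s)"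
        using s hS[OF rs] unfolding Y.MCauchy_def S.sub.MCauchy_def by (auto simp: D_def)
      then obtain l where l: "limitin S.sub.mtopology (h \<circ> s) l sequentially"
        using S.closedin_mcomplete_imp_mcomplete[OF clo comp] unfolding S.sub.mcomplete_def by blast
      have "\<forall>\<^sub>F n in sequentially. s n \<in> g ` ?S \<and> D (s n) (g l) < e" if "e > 0" for e
        using l that rs unfolding S.sub.limitin_metric D_def
        by (auto simp: hg elim!: allE[of _ e] eventually_mono)
      then have "limitin Y.mtopology s (g l) sequentially"
        using l unfolding S.sub.limitin_metric Y.limitin_metric by blast
      then show "\<exists>l. limitin Y.mtopology s l sequentially" by blast
    qed
    then show ?thesis by (simp add: m_def)
  qed
  have sep: "separable_space (mtopology_of m)"
  proof -
    obtain C where C: "countable C" "C \<subseteq> pm_carrier x"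
      "\<And>p r. p \<in> pm_carrier x \<Longrightarrow> r > 0 \<Longrightarrow> \<exists>c\<in>C. pm_dist x p c < r"
      by (rule pm_space_dense[OF x]) (rule that)
    define P where "P = (\<lambda>(c, n). SOME p. p \<in> ?S \<and> pm_dist x p c < 1 / real (Suc n))"
    define C' where "C' = g ` (P ` (C \<times> (UNIV :: nat set)) \<inter> ?S)"
    have "countable C'" unfolding C'_def using C(1) by auto
    moreover have "C' \<subseteq> topspace (mtopology_of m)" unfolding C'_def by auto
    moreover have "g p \<in> Y.mtopology closure_of C'" if p: "p \<in> ?S" for p
      unfolding Y.metric_closure_of
    proof (intro CollectI conjI allI impI)
      fix r :: real assume "r > 0"
      then obtain n where n: "1 / real (Suc n) < r / 2"
        by (metis half_gt_zero nat_approx_posE)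
      obtain c where c: "c \<in> C" "pm_dist x p c < 1 / real (Suc n)"
        using C(3)[of p "1 / real (Suc n)"] p pm_supp_subset[of x] by auto
      have q: "P (c, n) \<in> ?S" "pm_dist x (P (c, n)) c < 1 / real (Suc n)"
        using someI[of "\<lambda>p. p \<in> ?S \<and> pm_dist x p c < 1 / real (Suc n)" p] p c
        by (auto simp: P_def)
      have "pm_dist x p (P (c, n)) \<le> pm_dist x p c + pm_dist x c (P (c, n))"
        using p q c C(2) pm_supp_subset[of x] by (intro X.triangle) auto
      also have "\<dots> < r" using c q n X.commute[of c "P (c, n)"] by simp
      finally have "g (P (c, n)) \<in> Y.mball (g p) r"
        using p q by (simp add: dgg)
      moreover have "g (P (c, n)) \<in> C'" unfolding C'_def using c q by blast
      ultimately show "\<exists>u\<in>C'. u \<in> Y.mball (g p) r" by blast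
    qed (use p in auto)
    then have "mtopology_of m closure_of C' = topspace (mtopology_of m)"
      using closure_of_subset_topspace[of Y.mtopology C'] by auto
    ultimately show ?thesis unfolding separable_space_def by blast
  qed
  have prob: "prob_space N"
    unfolding N_def
  proof (rule prob_space.prob_space_distr[OF _ gm])
    show "prob_space (restrict_space (pm_measure x) ?S)"
      using emeasure_pm_supp[OF x] pm_supp_sets[OF x]
      by (intro prob_spaceI) (simp add: spS emeasure_restrict_space)
  qed
  have sp: "pm_space y"
    unfolding pm_space_def using compl sep prob by (simp add: N_def)
  have full: "pm_supp y = g ` ?S"
  proof (intro equalityI subsetI)
    fix u assume u: "u \<in> g ` ?S"
    then obtain p where p: "p \<in> ?S" "u = g p" by blast
    have "emeasure N U > 0" if U: "openin Y.mtopology U" "u \<in> U" for U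
    proof -
      obtain V where V: "openin (mtopology_of (pm_metric x)) V" "g -` U \<inter> ?S = V \<inter> ?S"
        using preim[OF U(1)] by blast
      have "U \<in> sets N" using U sub by (auto simp: N_def)
      then have "emeasure N U = emeasure (pm_measure x) V"
        using V emeasure_Int_supp[OF x pm_open_sets[OF x V(1)]] by (simp add: eN)
      moreover have "p \<in> V" using p U V by blast
      ultimately show ?thesis using p V(1) by (auto simp: pm_supp_def)
    qed
    with u show "u \<in> pm_supp y" by (auto simp: pm_supp_def)
  qed (auto simp: pm_supp_def)
  have "pm_iso x y"
  proof (rule pm_isoI[OF x sp, of g])
    show "bij_betw g ?S (pm_supp y)" using inj full by (simp add: bij_betw_def)
  qed (auto simp: dgg eN)
  with that[of y] sp full show ?thesis by (simp add: full_pm_space_def)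
qed

text \<open>A separable metric space has at most the cardinality of the continuum, so the pm-spaces
  whose points are real numbers (with an arbitrary metric, unrelated to the standard one)
  represent all isomorphism classes.\<close>

lemma pm_space_real_copy:
  fixes x :: "'a pm"
  assumes x: "pm_space x"
  shows "\<exists>y :: real pm. full_pm_space y \<and> pm_iso x y"
proof -
  interpret X: Metric_space "pm_carrier x" "pm_dist x" by simp
  obtain C where C: "countable C" "C \<subseteq> pm_carrier x"
    "\<And>p r. p \<in> pm_carrier x \<Longrightarrow> r > 0 \<Longrightarrow> \<exists>c\<in>C. pm_dist x p c < r"
    by (rule pm_space_dense[OF x]) (rule that)
  define k where "k = (\<lambda>p. to_nat_on (C \<times> (UNIV :: nat set)) `
      {(c, n). c \<in> C \<and> pm_dist x p c < 1 / real (Suc n)})"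
  have inj: "inj_on k (pm_carrier x)"
  proof (rule inj_onI, rule ccontr)
    fix p q assume pq: "p \<in> pm_carrier x" "q \<in> pm_carrier x" "k p = k q" "p \<noteq> q"
    have cnt: "countable (C \<times> (UNIV :: nat set))" using C(1) by auto
    have "{(c, n). c \<in> C \<and> pm_dist x p c < 1 / real (Suc n)}
        = {(c, n). c \<in> C \<and> pm_dist x q c < 1 / real (Suc n)}"
      using pq(3) unfolding k_def
      by (subst (asm) inj_on_image_eq_iff[OF inj_on_to_nat_on[OF cnt]]) auto
    then have eq: "pm_dist x p c < 1 / real (Suc n) \<longleftrightarrow> pm_dist x q c < 1 / real (Suc n)"
      if "c \<in> C" for c n
      using that by (auto simp: set_eq_iff)
    have "0 < pm_dist x p q" using pq by (simp add: X.mdist_pos_less)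
    then obtain n where n: "1 / real (Suc n) < pm_dist x p q / 2"
      by (metis half_gt_zero nat_approx_posE)
    obtain c where c: "c \<in> C" "pm_dist x p c < 1 / real (Suc n)"
      using C(3)[OF pq(1), of "1 / real (Suc n)"] by auto
    have "pm_dist x p q \<le> pm_dist x p c + pm_dist x c q"
      using pq c C(2) by (intro X.triangle) auto
    then show False using n c eq[OF c(1), of n] X.commute[of c q] by simp
  qed
  have "(UNIV :: nat set set) \<lesssim> (UNIV :: real set)"
    using nat_sets_eqpoll_reals eqpoll_imp_lepoll by blast
  then obtain j :: "nat set \<Rightarrow> real" where j: "inj j"
    by (auto simp: lepoll_def)
  have "inj_on (j \<circ> k) (pm_supp x)"
    using inj j pm_supp_subset[of x] by (meson comp_inj_on inj_on_subset subset_UNIV)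
  from pm_transport[OF x this] obtain y :: "real pm" where "full_pm_space y" "pm_iso x y" .
  then show ?thesis by blast
qed

lemma full_pm_space_exists: "\<exists>x :: real pm. full_pm_space x"
proof -
  interpret M: Metric_space "{0 :: real}" dist
    by (rule Met_TC.subspace) simp
  let ?A = "{U. openin M.mtopology U}"
  let ?N = "return (sigma {0 :: real} ?A) 0"
  let ?x = "\<lparr>pm_metric = metric ({0 :: real}, dist), pm_measure = ?N\<rparr>"
  have "M.mcomplete"
    unfolding M.mcomplete_def
  proof (intro allI impI)
    fix s assume "M.MCauchy s"
    then have "range s \<subseteq> {0}" unfolding M.MCauchy_def by (rule conjunct1)
    then have "s n = 0" for n by blast
    then have "limitin M.mtopology s 0 sequentially"
      unfolding M.limitin_metric by simp
    then show "\<exists>l. limitin M.mtopology s l sequentially" by blast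
  qed
  moreover have "separable_space M.mtopology"
    unfolding separable_space_def
  proof (intro exI conjI)
    show "M.mtopology closure_of {0} = topspace M.mtopology"
      using closure_of_topspace[of M.mtopology] by simp
  qed simp_all
  moreover have "prob_space ?N"
    by (rule prob_space_return) (simp add: space_measure_of_conv)
  ultimately have "pm_space ?x"
    unfolding pm_space_def by simp
  from pm_space_real_copy[OF this] show ?thesis by blast
qed


subsection \<open>The set of isomorphism classes\<close>

definition pm_equiv :: "real pm \<Rightarrow> real pm \<Rightarrow> bool" where
  "pm_equiv x y \<longleftrightarrow> pm_space x \<and> pm_space y \<and> pm_iso x y"

quotient_type pm_class = "real pm" / partial: pm_equiv
proof (rule part_equivpI)
  show "\<exists>x. pm_equiv x x"
    using full_pm_space_exists pm_iso_refl unfolding pm_equiv_def full_pm_space_def by blast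
  show "symp pm_equiv"
    unfolding pm_equiv_def by (auto intro!: sympI pm_iso_sym)
  show "transp pm_equiv"
    unfolding pm_equiv_def by (auto intro!: transpI intro: pm_iso_trans)
qed

text \<open>A class is represented by a space of full support. The choice among the isomorphic
  representatives is immaterial: see \<open>lip_le_abs\<close>, \<open>box_dist_abs\<close> and \<open>scale_abs\<close> below.\<close>

definition repr :: "pm_class \<Rightarrow> real pm" where
  "repr X = (SOME x. full_pm_space x \<and> abs_pm_class x = X)"

lemma repr:
  shows "full_pm_space (repr X)" and "abs_pm_class (repr X) = X"
proof -
  let ?r = "rep_pm_class X"
  have r: "pm_space ?r" "abs_pm_class ?r = X"
    using Quotient_rep_reflp[OF Quotient_pm_class, of X] Quotient_abs_rep[OF Quotient_pm_class, of X]
    by (auto simp: pm_equiv_def)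
  obtain y :: "real pm" where y: "full_pm_space y" "pm_iso ?r y"
    using pm_space_real_copy[OF r(1)] by blast
  then have "abs_pm_class ?r = abs_pm_class y"
    using r by (intro Quotient_rel_abs[OF Quotient_pm_class]) (auto simp: pm_equiv_def full_pm_space_def)
  with y r have "full_pm_space y \<and> abs_pm_class y = X" by simp
  from someI[of "\<lambda>x. full_pm_space x \<and> abs_pm_class x = X", OF this]
  show "full_pm_space (repr X)" "abs_pm_class (repr X) = X"
    by (simp_all add: repr_def)
qed


subsection \<open>Lipschitz order, box distance and scaling on representatives\<close>

text \<open>\<open>pm_dominated y x\<close> is \<open>y \<prec> x\<close>; the pushforward condition needs a Borel map, and
  1-Lipschitz maps are Borel.\<close>

definition pm_dominated :: "'b pm \<Rightarrow> 'a pm \<Rightarrow> bool" where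
  "pm_dominated y x \<longleftrightarrow>
     (\<exists>\<phi>. \<phi> \<in> pm_measure x \<rightarrow>\<^sub>M pm_measure y \<and>
          (\<forall>p\<in>pm_carrier x. \<forall>q\<in>pm_carrier x. pm_dist y (\<phi> p) (\<phi> q) \<le> pm_dist x p q) \<and>
          distr (pm_measure x) (pm_measure y) \<phi> = pm_measure y)"

abbreviation unit_interval :: "real measure" where
  "unit_interval \<equiv> restrict_space lborel {0..1}"

definition pm_parameter :: "'a pm \<Rightarrow> (real \<Rightarrow> 'a) \<Rightarrow> bool" where
  "pm_parameter x a \<longleftrightarrow>
     a \<in> unit_interval \<rightarrow>\<^sub>M pm_measure x \<and> distr unit_interval (pm_measure x) a = pm_measure x"

definition pm_box_bound :: "'a pm \<Rightarrow> 'b pm \<Rightarrow> real \<Rightarrow> bool" where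
  "pm_box_bound x y \<epsilon> \<longleftrightarrow>
     (\<exists>a b I\<^sub>0. pm_parameter x a \<and> pm_parameter y b \<and>
        I\<^sub>0 \<in> sets borel \<and> I\<^sub>0 \<subseteq> {0..1} \<and> measure lborel I\<^sub>0 \<ge> 1 - \<epsilon> \<and>
        (\<forall>s\<in>I\<^sub>0. \<forall>t\<in>I\<^sub>0. \<bar>pm_dist x (a s) (a t) - pm_dist y (b s) (b t)\<bar> \<le> \<epsilon>))"

text \<open>The infimum is over a nonempty set, since every pm-space has a parameter and \<open>\<epsilon> = 1\<close>
  is admissible with empty \<open>I\<^sub>0\<close>.\<close>

definition pm_box :: "'a pm \<Rightarrow> 'b pm \<Rightarrow> real" where
  "pm_box x y = Inf {\<epsilon>. \<epsilon> > 0 \<and> pm_box_bound x y \<epsilon>}"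

text \<open>Meaningful for \<open>t > 0\<close> only, and only used there.\<close>

definition pm_scale :: "real \<Rightarrow> 'a pm \<Rightarrow> 'a pm" where
  "pm_scale t x =
     \<lparr>pm_metric = metric (pm_carrier x, \<lambda>p q. t * pm_dist x p q), pm_measure = pm_measure x\<rparr>"


subsection \<open>Lipschitz order, box topology and scaling on classes\<close>

text \<open>\<open>lip_le Y X\<close> is \<open>Y \<prec> X\<close>.\<close>

definition lip_le :: "pm_class \<Rightarrow> pm_class \<Rightarrow> bool" where
  "lip_le Y X \<longleftrightarrow> pm_dominated (repr Y) (repr X)"

definition box_dist :: "pm_class \<Rightarrow> pm_class \<Rightarrow> real" where
  "box_dist X Y = pm_box (repr X) (repr Y)"

text \<open>The topology of the metric \<open>box_dist\<close>; the definition does not presuppose the metric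
  axioms (see \<open>openin_box_topology\<close>).\<close>

definition box_topology :: "pm_class topology" where
  "box_topology = topology (\<lambda>U. \<forall>X\<in>U. \<exists>r>0. \<forall>Y. box_dist X Y < r \<longrightarrow> Y \<in> U)"

definition scale :: "real \<Rightarrow> pm_class \<Rightarrow> pm_class" where
  "scale t X = abs_pm_class (pm_scale t (repr X))"


subsection \<open>Independence of the choice of representatives\<close>

lemma full_iso_map:
  assumes x: "full_pm_space x" and y: "full_pm_space y" and i: "pm_iso x y"
  obtains f where "f \<in> pm_measure x \<rightarrow>\<^sub>M pm_measure y"
    "distr (pm_measure x) (pm_measure y) f = pm_measure y"
    "\<And>p q. p \<in> pm_carrier x \<Longrightarrow> q \<in> pm_carrier x \<Longrightarrow> pm_dist y (f p) (f q) = pm_dist x p q"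
    "f ` pm_carrier x \<subseteq> pm_carrier y"
proof -
  have px: "pm_space x" "pm_supp x = pm_carrier x" and py: "pm_supp y = pm_carrier y"
    using x y by (auto simp: full_pm_space_def)
  have "restrict_space (pm_measure x) (space (pm_measure x)) = pm_measure x"
    by (rule measure_eqI)
      (auto simp: sets_restrict_space_iff emeasure_restrict_space dest: sets.sets_into_space[THEN subsetD])
  then have "restrict_space (pm_measure x) (pm_carrier x) = pm_measure x"
    by (simp add: pm_space_sets(2)[OF px(1)])
  then obtain f where "bij_betw f (pm_carrier x) (pm_carrier y)"
    "\<forall>p\<in>pm_carrier x. \<forall>q\<in>pm_carrier x. pm_dist y (f p) (f q) = pm_dist x p q"
    "f \<in> pm_measure x \<rightarrow>\<^sub>M pm_measure y" "distr (pm_measure x) (pm_measure y) f = pm_measure y"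
    using i unfolding pm_iso_def px(2) py by auto
  then show ?thesis by (intro that[of f]) (auto simp: bij_betw_def)
qed

lemma pm_dominated_iso:
  assumes x: "full_pm_space x" "full_pm_space x'" "pm_iso x' x"
    and y: "full_pm_space y" "full_pm_space y'" "pm_iso y y'"
    and d: "pm_dominated y x"
  shows "pm_dominated y' x'"
proof -
  obtain f where f: "f \<in> pm_measure x' \<rightarrow>\<^sub>M pm_measure x"
    "distr (pm_measure x') (pm_measure x) f = pm_measure x"
    "\<And>p q. p \<in> pm_carrier x' \<Longrightarrow> q \<in> pm_carrier x' \<Longrightarrow> pm_dist x (f p) (f q) = pm_dist x' p q"
    "f ` pm_carrier x' \<subseteq> pm_carrier x"
    by (rule full_iso_map[OF x(2,1,3)]) (rule that)
  obtain g where g: "g \<in> pm_measure y \<rightarrow>\<^sub>M pm_measure y'"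
    "distr (pm_measure y) (pm_measure y') g = pm_measure y'"
    "\<And>p q. p \<in> pm_carrier y \<Longrightarrow> q \<in> pm_carrier y \<Longrightarrow> pm_dist y' (g p) (g q) = pm_dist y p q"
    by (rule full_iso_map[OF y]) (rule that)
  obtain h where h: "h \<in> pm_measure x \<rightarrow>\<^sub>M pm_measure y"
    "\<forall>p\<in>pm_carrier x. \<forall>q\<in>pm_carrier x. pm_dist y (h p) (h q) \<le> pm_dist x p q"
    "distr (pm_measure x) (pm_measure y) h = pm_measure y"
    using d unfolding pm_dominated_def by blast
  have hc: "h p \<in> pm_carrier y" if "p \<in> pm_carrier x" for p
    using measurable_space[OF h(1)] that x y by (simp add: full_pm_space_def pm_space_sets)
  have hf: "h \<circ> f \<in> pm_measure x' \<rightarrow>\<^sub>M pm_measure y"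
    using f(1) h(1) by (rule measurable_comp)
  show ?thesis
    unfolding pm_dominated_def
  proof (intro exI[of _ "g \<circ> (h \<circ> f)"] conjI ballI)
    show "g \<circ> (h \<circ> f) \<in> pm_measure x' \<rightarrow>\<^sub>M pm_measure y'"
      using hf g(1) by (rule measurable_comp)
    show "distr (pm_measure x') (pm_measure y') (g \<circ> (h \<circ> f)) = pm_measure y'"
      by (simp only: distr_distr[OF g(1) hf, symmetric] distr_distr[OF h(1) f(1), symmetric] f(2) g(2) h(3))
    fix p q assume pq: "p \<in> pm_carrier x'" "q \<in> pm_carrier x'"
    then have "f p \<in> pm_carrier x" "f q \<in> pm_carrier x" using f(4) by auto
    then show "pm_dist y' ((g \<circ> (h \<circ> f)) p) ((g \<circ> (h \<circ> f)) q) \<le> pm_dist x' p q"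
      using h(2) f(3)[OF pq] g(3)[OF hc hc] by fastforce
  qed
qed

lemma pm_parameter_iso:
  assumes "f \<in> pm_measure x \<rightarrow>\<^sub>M pm_measure y"
    "distr (pm_measure x) (pm_measure y) f = pm_measure y" "pm_parameter x a"
  shows "pm_parameter y (f \<circ> a)"
  using assms unfolding pm_parameter_def
  by (auto simp: distr_distr[symmetric])

lemma pm_box_bound_iso:
  assumes x: "full_pm_space x" "full_pm_space x'" "pm_iso x x'"
    and y: "full_pm_space y" "full_pm_space y'" "pm_iso y y'"
    and b: "pm_box_bound x y \<epsilon>"
  shows "pm_box_bound x' y' \<epsilon>"
proof -
  obtain f where f: "f \<in> pm_measure x \<rightarrow>\<^sub>M pm_measure x'"
    "distr (pm_measure x) (pm_measure x') f = pm_measure x'"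
    "\<And>p q. p \<in> pm_carrier x \<Longrightarrow> q \<in> pm_carrier x \<Longrightarrow> pm_dist x' (f p) (f q) = pm_dist x p q"
    by (rule full_iso_map[OF x]) (rule that)
  obtain g where g: "g \<in> pm_measure y \<rightarrow>\<^sub>M pm_measure y'"
    "distr (pm_measure y) (pm_measure y') g = pm_measure y'"
    "\<And>p q. p \<in> pm_carrier y \<Longrightarrow> q \<in> pm_carrier y \<Longrightarrow> pm_dist y' (g p) (g q) = pm_dist y p q"
    by (rule full_iso_map[OF y]) (rule that)
  obtain a b I where I: "pm_parameter x a" "pm_parameter y b"
    "I \<in> sets borel" "I \<subseteq> {0..1}" "measure lborel I \<ge> 1 - \<epsilon>"
    "\<forall>s\<in>I. \<forall>t\<in>I. \<bar>pm_dist x (a s) (a t) - pm_dist y (b s) (b t)\<bar> \<le> \<epsilon>"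
    using b unfolding pm_box_bound_def by blast
  have a: "a s \<in> pm_carrier x" and b: "b s \<in> pm_carrier y" if "s \<in> I" for s
    using I(1,2,4) that x(1) y(1) measurable_space[of a unit_interval "pm_measure x" s]
      measurable_space[of b unit_interval "pm_measure y" s]
    by (auto simp: pm_parameter_def full_pm_space_def pm_space_sets)
  show ?thesis
    unfolding pm_box_bound_def
  proof (intro exI[of _ "f \<circ> a"] exI[of _ "g \<circ> b"] exI[of _ I] conjI ballI)
    show "pm_parameter x' (f \<circ> a)" by (rule pm_parameter_iso[OF f(1,2) I(1)])
    show "pm_parameter y' (g \<circ> b)" by (rule pm_parameter_iso[OF g(1,2) I(2)])
    fix s t assume "s \<in> I" "t \<in> I"
    then show "\<bar>pm_dist x' ((f \<circ> a) s) ((f \<circ> a) t) - pm_dist y' ((g \<circ> b) s) ((g \<circ> b) t)\<bar> \<le> \<epsilon>"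
      using I(6) by (simp add: f(3) g(3) a b)
  qed (use I in auto)
qed

lemma repr_abs:
  assumes "full_pm_space x"
  shows "pm_iso (repr (abs_pm_class x)) x" "pm_iso x (repr (abs_pm_class x))"
proof -
  let ?r = "repr (abs_pm_class x)"
  have s: "pm_space ?r" "pm_space x"
    using repr(1) assms by (auto simp: full_pm_space_def)
  then have "pm_equiv ?r ?r" "pm_equiv x x"
    using pm_iso_refl by (auto simp: pm_equiv_def)
  then have "pm_equiv ?r x"
    using Quotient_rel[OF Quotient_pm_class, of ?r x] by (simp add: repr(2))
  then show "pm_iso ?r x" "pm_iso x ?r"
    using s pm_iso_sym by (auto simp: pm_equiv_def)
qed

lemma abs_pm_class_eq:
  "pm_space x \<Longrightarrow> pm_space y \<Longrightarrow> abs_pm_class x = abs_pm_class y \<longleftrightarrow> pm_iso x y"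
  using Quotient_rel[OF Quotient_pm_class, of x y] pm_iso_refl by (auto simp: pm_equiv_def)

lemma lip_le_abs:
  assumes "full_pm_space x" "full_pm_space y"
  shows "lip_le (abs_pm_class y) (abs_pm_class x) \<longleftrightarrow> pm_dominated y x"
  unfolding lip_le_def
  using pm_dominated_iso[OF repr(1) assms(1) repr_abs(2)[OF assms(1)] repr(1) assms(2) repr_abs(1)[OF assms(2)]]
    pm_dominated_iso[OF assms(1) repr(1) repr_abs(1)[OF assms(1)] assms(2) repr(1) repr_abs(2)[OF assms(2)]]
  by blast

lemma box_dist_abs:
  assumes "full_pm_space x" "full_pm_space y"
  shows "box_dist (abs_pm_class x) (abs_pm_class y) = pm_box x y"
proof -
  have "pm_box_bound (repr (abs_pm_class x)) (repr (abs_pm_class y)) e \<longleftrightarrow> pm_box_bound x y e" for e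
    using pm_box_bound_iso[OF repr(1) assms(1) repr_abs(1)[OF assms(1)] repr(1) assms(2) repr_abs(1)[OF assms(2)]]
      pm_box_bound_iso[OF assms(1) repr(1) repr_abs(2)[OF assms(1)] assms(2) repr(1) repr_abs(2)[OF assms(2)]]
    by blast
  then show ?thesis by (simp add: box_dist_def pm_box_def)
qed

lemma pm_scale_simps:
  assumes "t > 0"
  shows "pm_carrier (pm_scale t x) = pm_carrier x"
    "pm_dist (pm_scale t x) p q = t * pm_dist x p q"
    "pm_measure (pm_scale t x) = pm_measure x"
    "mtopology_of (pm_metric (pm_scale t x)) = mtopology_of (pm_metric x)"
    "pm_supp (pm_scale t x) = pm_supp x"
proof -
  interpret X: Metric_space "pm_carrier x" "pm_dist x" by simp
  interpret T: Metric_space "pm_carrier x" "\<lambda>p q. t * pm_dist x p q"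
  proof
    fix p q r
    show "0 \<le> t * pm_dist x p q" "t * pm_dist x p q = t * pm_dist x q p"
      using assms X.commute[of p q] by auto
    show "(t * pm_dist x p q = 0) = (p = q)" if "p \<in> pm_carrier x" "q \<in> pm_carrier x"
      using that assms by simp
    show "t * pm_dist x p r \<le> t * pm_dist x p q + t * pm_dist x q r"
      if "p \<in> pm_carrier x" "q \<in> pm_carrier x" "r \<in> pm_carrier x"
      using X.triangle[OF that] assms by (simp flip: distrib_left)
  qed
  show c: "pm_carrier (pm_scale t x) = pm_carrier x"
    and d: "pm_dist (pm_scale t x) p q = t * pm_dist x p q" for p q
    by (simp_all add: pm_scale_def)
  show m: "pm_measure (pm_scale t x) = pm_measure x"
    by (simp add: pm_scale_def)
  have "openin (mtopology_of (pm_metric (pm_scale t x))) U \<longleftrightarrow>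
      openin (mtopology_of (pm_metric x)) U" for U
  proof -
    have "(\<exists>r>0. \<forall>q\<in>pm_carrier x. t * pm_dist x p q < r \<longrightarrow> q \<in> U) \<longleftrightarrow>
        (\<exists>r>0. \<forall>q\<in>pm_carrier x. pm_dist x p q < r \<longrightarrow> q \<in> U)" (is "?l \<longleftrightarrow> ?r") for p
    proof
      assume ?l
      then obtain r where "r > 0" "\<forall>q\<in>pm_carrier x. t * pm_dist x p q < r \<longrightarrow> q \<in> U" by blast
      then show ?r using assms by (intro exI[of _ "r / t"]) (simp add: field_simps)
    next
      assume ?r
      then obtain r where "r > 0" "\<forall>q\<in>pm_carrier x. pm_dist x p q < r \<longrightarrow> q \<in> U" by blast
      then show ?l using assms by (intro exI[of _ "t * r"]) simp
    qed
    then show ?thesis unfolding openin_mtopology_of by (simp add: c d)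
  qed
  then show top: "mtopology_of (pm_metric (pm_scale t x)) = mtopology_of (pm_metric x)"
    by (simp add: topology_eq)
  show "pm_supp (pm_scale t x) = pm_supp x"
    by (simp add: pm_supp_def c m top)
qed

lemma pm_space_scale:
  assumes t: "t > 0" and x: "pm_space x"
  shows "pm_space (pm_scale t x)"
proof -
  interpret X: Metric_space "pm_carrier x" "pm_dist x" by simp
  interpret T: Metric_space "pm_carrier x" "pm_dist (pm_scale t x)"
    using Metric_space_mspace_mdist[of "pm_metric (pm_scale t x)"] by (simp add: pm_scale_simps[OF t])
  have top: "T.mtopology = X.mtopology"
    using pm_scale_simps(1,4)[OF t, of x] by (simp add: mtopology_of_def)
  have "X.mcomplete" using x by (simp add: pm_space_def mcomplete_of_def)
  have "T.mcomplete"
    unfolding T.mcomplete_def top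
  proof (intro allI impI)
    fix s assume s: "T.MCauchy s"
    have "X.MCauchy s"
      unfolding X.MCauchy_def
    proof (intro conjI allI impI)
      show "range s \<subseteq> pm_carrier x" using s unfolding T.MCauchy_def by (rule conjunct1)
      fix e :: real assume "e > 0"
      then have "t * e > 0" using t by simp
      then obtain N where "\<forall>n n'. N \<le> n \<longrightarrow> N \<le> n' \<longrightarrow> pm_dist (pm_scale t x) (s n) (s n') < t * e"
        using s unfolding T.MCauchy_def by blast
      then show "\<exists>N. \<forall>n n'. N \<le> n \<longrightarrow> N \<le> n' \<longrightarrow> pm_dist x (s n) (s n') < e"
        using t by (simp add: pm_scale_simps(2)) blast
    qed
    then show "\<exists>l. limitin X.mtopology s l sequentially"
      using \<open>X.mcomplete\<close> unfolding X.mcomplete_def by blast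
  qed
  then show ?thesis
    using x by (simp add: pm_space_def pm_scale_simps[OF t] mcomplete_of_def)
qed

lemma scale_abs:
  assumes t: "t > 0" and x: "full_pm_space x"
  shows "scale t (abs_pm_class x) = abs_pm_class (pm_scale t x)"
proof -
  let ?r = "repr (abs_pm_class x)"
  have s: "pm_space ?r" "pm_space x"
    using repr(1) x by (auto simp: full_pm_space_def)
  have "pm_iso (pm_scale t ?r) (pm_scale t x)"
    using repr_abs(1)[OF x] t unfolding pm_iso_def by (simp add: pm_scale_simps)
  then show ?thesis
    unfolding scale_def using s t by (simp add: abs_pm_class_eq pm_space_scale)
qed

lemma openin_box_topology:
  "openin box_topology U \<longleftrightarrow> (\<forall>X\<in>U. \<exists>r>0. \<forall>Y. box_dist X Y < r \<longrightarrow> Y \<in> U)"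
proof -
  let ?P = "\<lambda>U. \<forall>X\<in>U. \<exists>r>0. \<forall>Y. box_dist X Y < r \<longrightarrow> Y \<in> U"
  have "\<exists>r>0. \<forall>Y. box_dist X Y < r \<longrightarrow> Y \<in> S \<inter> T"
    if S: "?P S" and T: "?P T" and X: "X \<in> S \<inter> T" for S T X
  proof -
    obtain r where r: "r > 0" "\<forall>Y. box_dist X Y < r \<longrightarrow> Y \<in> S" using S X by blast
    obtain r' where r': "r' > 0" "\<forall>Y. box_dist X Y < r' \<longrightarrow> Y \<in> T" using T X by blast
    show ?thesis by (rule exI[of _ "min r r'"]) (use r r' in auto)
  qed
  then have "\<forall>S T. ?P S \<longrightarrow> ?P T \<longrightarrow> ?P (S \<inter> T)" by (intro allI impI ballI)
  moreover have "\<forall>K. (\<forall>S\<in>K. ?P S) \<longrightarrow> ?P (\<Union>K)"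
  proof (intro allI impI ballI)
    fix K X assume K: "\<forall>S\<in>K. ?P S" and "X \<in> \<Union>K"
    then obtain S where S: "S \<in> K" "X \<in> S" by blast
    then obtain r where "r > 0" "\<forall>Y. box_dist X Y < r \<longrightarrow> Y \<in> S" using K by blast
    then show "\<exists>r>0. \<forall>Y. box_dist X Y < r \<longrightarrow> Y \<in> \<Union>K" using S(1) by blast
  qed
  ultimately have "istopology ?P"
    unfolding istopology_def by (rule conjI)
  then show ?thesis by (simp add: box_topology_def)
qed

lemma topspace_box_topology: "topspace box_topology = UNIV"
  unfolding topspace_def using openin_box_topology[of UNIV] by (auto intro: exI[of _ 1])


subsection \<open>Functionals and sets\<close>

definition homogeneous :: "(pm_class \<Rightarrow> ennreal) \<Rightarrow> bool" where
  "homogeneous F \<longleftrightarrow> (\<forall>t>0. \<forall>X. F (scale t X) = ennreal t * F X)"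

definition lip_monotone :: "(pm_class \<Rightarrow> ennreal) \<Rightarrow> bool" where
  "lip_monotone F \<longleftrightarrow> (\<forall>X Y. lip_le X Y \<longrightarrow> F X \<le> F Y)"

definition box_lsc :: "(pm_class \<Rightarrow> ennreal) \<Rightarrow> bool" where
  "box_lsc F \<longleftrightarrow> (\<forall>c. openin box_topology {X. c < F X})"

definition downward_closed :: "pm_class set \<Rightarrow> bool" where
  "downward_closed A \<longleftrightarrow> (\<forall>X Y. X \<in> A \<longrightarrow> lip_le Y X \<longrightarrow> Y \<in> A)"

definition functionals :: "(pm_class \<Rightarrow> ennreal) set" where
  "functionals = {F. homogeneous F \<and> lip_monotone F \<and> box_lsc F}"

definition closed_down_sets :: "pm_class set set" where
  "closed_down_sets = {A. downward_closed A \<and> closedin box_topology A}"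

definition scale_set :: "real \<Rightarrow> pm_class set \<Rightarrow> pm_class set" where
  "scale_set t A = scale t ` A"

text \<open>In \<open>ennreal\<close>, the infimum of the empty set is \<open>\<infinity>\<close>.\<close>

definition functional_of :: "pm_class set \<Rightarrow> pm_class \<Rightarrow> ennreal" where
  "functional_of A X = Inf {ennreal t | t. t > 0 \<and> X \<in> scale_set t A}"

end

(* The inverse of A \<mapsto> F_A is F \<mapsto> {F \<le> 1}. That F is recovered from {F \<le> 1} is homogeneity. That A is
   recovered as {F_A \<le> 1} is closedness of A, because tX tends to X in the box topology as t tends
   to 1. This convergence, and the comparison of box distances under scaling, use that every pm-space
   has a parameter: code the space injectively into the reals by the bits telling which balls of a
   countable base contain a point, decode measurably by a limit of centres, and compose the decoding
   with the quantile function of the image measure. *)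

theory Submission
  imports Defs
begin

section \<open>Existence of parameters\<close>

text \<open>The code writes the truth values as base 4 digits 0 and 1. The tail after any digit is
  at most 1/3 of a unit of that digit, so expansions cannot collide as binary ones do (0.0111... =
  0.1), and each digit is read off as the parity of a floor.\<close>

lemma binary_code:
  fixes P :: "nat \<Rightarrow> 'a \<Rightarrow> bool"
  assumes P [measurable]: "\<And>i. Measurable.pred M (P i)"
  obtains g :: "'a \<Rightarrow> real" and B :: "nat \<Rightarrow> real set"
  where "g \<in> borel_measurable M" "\<And>i. B i \<in> sets borel" "\<And>i x. g x \<in> B i \<longleftrightarrow> P i x"
proof -
  define b :: "'a \<Rightarrow> nat \<Rightarrow> real" where "b = (\<lambda>x i. of_bool (P i x) * (1/4) ^ Suc i)"
  define g where "g = (\<lambda>x. \<Sum>i. b x i)"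
  define B where "B = (\<lambda>i. {r :: real. odd \<lfloor>4 ^ Suc i * r\<rfloor>})"
  have geo: "summable (\<lambda>i. (1/4 :: real) ^ Suc i)" "(\<Sum>i. (1/4 :: real) ^ Suc i) = 1/3"
    using sums_mult[OF geometric_sums[of "1/4 :: real"], of "1/4"]
    by (auto simp: sums_iff)
  have summ: "summable (b x)" for x
    by (rule summable_comparison_test_ev[OF _ geo(1)]) (auto simp: b_def)
  have "g \<in> borel_measurable M"
    unfolding g_def b_def by measurable
  moreover have "B i \<in> sets borel" for i
    unfolding B_def by measurable
  moreover have "g x \<in> B n \<longleftrightarrow> P n x" for n x
  proof -
    \<comment> \<open>\<open>K\<close> and \<open>T\<close> are the integer and fractional parts of
      \<open>4 ^ Suc n * g x\<close>. In \<open>K\<close> every term with \<open>i < n\<close> is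
      even, so the parity of \<open>K\<close> is the digit \<open>P n x\<close>.\<close>
    define K :: int where "K = (\<Sum>i<Suc n. of_bool (P i x) * 4 ^ (n - i))"
    define T where "T = (\<Sum>i. of_bool (P (i + Suc n) x) * (1/4 :: real) ^ Suc i)"
    have "summable (\<lambda>i. of_bool (P (i + Suc n) x) * (1/4 :: real) ^ Suc i)"
      by (rule summable_comparison_test_ev[OF _ geo(1)]) auto
    then have T: "0 \<le> T" "T \<le> 1/3"
      unfolding T_def geo(2)[symmetric] by (auto intro!: suminf_nonneg suminf_le geo(1))
    have "4 ^ Suc n * g x = 4 ^ Suc n * (\<Sum>i. b x (i + Suc n)) + 4 ^ Suc n * (\<Sum>i<Suc n. b x i)"
      unfolding g_def by (subst suminf_split_initial_segment[OF summ, of _ "Suc n"]) (simp add: distrib_left)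
    also have "4 ^ Suc n * (\<Sum>i. b x (i + Suc n)) = (\<Sum>i. 4 ^ Suc n * b x (i + Suc n))"
      by (intro suminf_mult[symmetric] summable_ignore_initial_segment summ)
    also have "\<dots> = T"
      unfolding T_def b_def by (intro suminf_cong) (simp add: power_add power_divide)
    also have "4 ^ Suc n * (\<Sum>i<Suc n. b x i) = (\<Sum>i<Suc n. of_bool (P i x) * 4 ^ (n - i))"
      unfolding sum_distrib_left b_def
      by (intro sum.cong refl) (auto simp: power_divide power_diff field_simps)
    also have "\<dots> = real_of_int K" unfolding K_def by simp
    finally have "\<lfloor>4 ^ Suc n * g x\<rfloor> = K"
      using T by (intro floor_unique) auto
    moreover have "even (\<Sum>i<n. of_bool (P i x) * 4 ^ (n - i) :: int)"
      by (intro dvd_sum) auto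
    ultimately show ?thesis by (simp add: B_def K_def)
  qed
  ultimately show ?thesis by (rule that)
qed

text \<open>The quantile transform; \<open>0\<close> and \<open>1\<close> are excluded in the library version.\<close>

lemma unit_interval_distr_real:
  assumes "real_distribution N"
  obtains q where "q \<in> unit_interval \<rightarrow>\<^sub>M N" "distr unit_interval N q = N"
proof -
  interpret cdf_distribution N using assms by (simp add: cdf_distribution_def)
  let ?J = "restrict_space lborel {0<..<1 :: real}"
  \<comment> \<open>The value 0 outside the open interval is an arbitrary filler: the two endpoints
    form a null set.\<close>
  define q where "q = (\<lambda>s. if s \<in> {0<..<1} then I s else 0)"
  have I: "I \<in> borel_measurable ?J"
    using measurable_CI by (simp cong: measurable_cong_sets add: sets_restrict_space)
  have q: "q \<in> borel_measurable lborel"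
    unfolding q_def using I by (subst measurable_restrict_space_iff[symmetric]) auto
  then have qu: "q \<in> borel_measurable unit_interval"
    by (rule measurable_restrict_space1)
  have "distr unit_interval borel q = distr ?J borel I"
  proof (rule measure_eqI)
    fix A assume "A \<in> sets (distr unit_interval borel q)"
    then have A: "A \<in> sets borel" by simp
    have qA: "q -` A \<in> sets borel"
      using measurable_sets[OF q A] by simp
    have IA: "I -` A \<inter> {0<..<1} = q -` A \<inter> {0<..<1}"
      by (auto simp: q_def)
    have "emeasure (distr unit_interval borel q) A = emeasure lborel (q -` A \<inter> {0..1})"
      using A qu qA by (simp add: emeasure_distr space_restrict_space emeasure_restrict_space)
    also have "\<dots> = emeasure lborel (q -` A \<inter> {0<..<1})"
    proof (rule emeasure_eq_AE)
      show "AE s in lborel. s \<in> q -` A \<inter> {0..1} \<longleftrightarrow> s \<in> q -` A \<inter> {0<..<1}"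
        using AE_lborel_singleton[of 0] AE_lborel_singleton[of 1] by eventually_elim auto
    qed (use qA in auto)
    also have "\<dots> = emeasure (distr ?J borel I) A"
      using A I qA by (simp add: emeasure_distr space_restrict_space emeasure_restrict_space IA)
    finally show "emeasure (distr unit_interval borel q) A = emeasure (distr ?J borel I) A" .
  qed simp
  then have "distr unit_interval N q = N"
    using distr_I_eq_M by (simp cong: distr_cong)
  with qu show ?thesis using that[of q] by simp
qed


text \<open>By separability every open set is a countable union of balls centred in a countable
  dense set, so measurability of the distances to fixed points suffices.\<close>

lemma measurable_pm_measureI:
  assumes x: "pm_space x"
    and h: "\<And>r. r \<in> space M \<Longrightarrow> h r \<in> pm_carrier x"
    and d: "\<And>c. c \<in> pm_carrier x \<Longrightarrow> (\<lambda>r. pm_dist x c (h r)) \<in> borel_measurable M"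
  shows "h \<in> M \<rightarrow>\<^sub>M pm_measure x"
proof (rule measurable_sigma_sets[OF pm_space_sets(1)[OF x]])
  show "{U. openin (mtopology_of (pm_metric x)) U} \<subseteq> Pow (pm_carrier x)"
    using openin_subset by fastforce
  show "h \<in> space M \<rightarrow> pm_carrier x" using h by auto
  fix U assume "U \<in> {U. openin (mtopology_of (pm_metric x)) U}"
  then have U: "openin (mtopology_of (pm_metric x)) U" by simp
  obtain C where C: "countable C" "C \<subseteq> pm_carrier x"
    "\<And>p r. p \<in> pm_carrier x \<Longrightarrow> r > 0 \<Longrightarrow> \<exists>c\<in>C. pm_dist x p c < r"
    by (rule pm_space_dense[OF x]) (rule that)
  define b where "b = (\<lambda>c n. mball_of (pm_metric x) c (1 / real (Suc n)))"
  have "h -` U \<inter> space M =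
      (\<Union>c\<in>C. \<Union>n\<in>{n. b c n \<subseteq> U}. {r \<in> space M. pm_dist x c (h r) < 1 / real (Suc n)})"
    (is "?l = ?r")
  proof (intro equalityI subsetI)
    fix r assume r: "r \<in> ?l"
    obtain c n where cn: "c \<in> C" "h r \<in> b c n" "b c n \<subseteq> U"
      unfolding b_def by (rule dense_mball[OF C(3,2) U, of "h r"]) (use r in auto)
    then have "pm_dist x c (h r) < 1 / real (Suc n)"
      by (auto simp: b_def)
    with cn r show "r \<in> ?r" by blast
  next
    fix r assume "r \<in> ?r"
    then obtain c n where cn: "c \<in> C" "b c n \<subseteq> U" "r \<in> space M" "pm_dist x c (h r) < 1 / real (Suc n)"
      by blast
    then have "h r \<in> b c n" using C(2) h by (auto simp: b_def)
    with cn show "r \<in> ?l" by blast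
  qed
  also have "\<dots> \<in> sets M"
  proof (intro sets.countable_UN''[OF C(1)] sets.countable_UN'' countableI_type)
    fix c n assume "c \<in> C"
    then have [measurable]: "(\<lambda>r. pm_dist x c (h r)) \<in> borel_measurable M" using d C(2) by auto
    show "{r \<in> space M. pm_dist x c (h r) < 1 / real (Suc n)} \<in> sets M" by measurable
  qed
  finally show "h -` U \<inter> space M \<in> sets M" .
qed

text \<open>The code of \<open>p\<close> records which balls about dense points contain
  \<open>p\<close>; the decoder picks a centre for each radius and takes the limit. Having
  \<open>h\<close> Borel on the whole line avoids any question about the range of
  \<open>g\<close>.\<close>

lemma pm_space_real_embedding:
  assumes x: "pm_space x"
  obtains g h where "g \<in> pm_measure x \<rightarrow>\<^sub>M (borel :: real measure)"
    "h \<in> (borel :: real measure) \<rightarrow>\<^sub>M pm_measure x" "\<And>p. p \<in> pm_carrier x \<Longrightarrow> h (g p) = p"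
proof -
  interpret X: Metric_space "pm_carrier x" "pm_dist x" by simp
  interpret P: prob_space "pm_measure x" using x by (simp add: pm_space_def)
  have compl: "X.mcomplete" using x by (simp add: pm_space_def mcomplete_of_def)
  obtain C where C: "countable C" "C \<subseteq> pm_carrier x"
    "\<And>p r. p \<in> pm_carrier x \<Longrightarrow> r > 0 \<Longrightarrow> \<exists>c\<in>C. pm_dist x p c < r"
    by (rule pm_space_dense[OF x]) (rule that)
  have "pm_carrier x \<noteq> {}" using P.not_empty pm_space_sets(2)[OF x] by simp
  then have "C \<noteq> {}" using C(3) zero_less_one by blast
  define c where "c = from_nat_into C"
  have cC: "c k \<in> pm_carrier x" for k
    using from_nat_into[OF \<open>C \<noteq> {}\<close>] C(2) by (auto simp: c_def)
  have dense: "\<exists>k. pm_dist x (c k) p < r" if "p \<in> pm_carrier x" "r > 0" for p r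
    using C(3)[OF that] from_nat_into_surj[OF C(1)] X.commute unfolding c_def by metis
  \<comment> \<open>The index \<open>i\<close> encodes a pair (k, n): the ball of radius 1/(n+1)
    about the k-th dense point.\<close>
  define R where "R = (\<lambda>i p. pm_dist x (c (fst (prod_decode i))) p < 1 / real (Suc (snd (prod_decode i))))"
  have "Measurable.pred (pm_measure x) (R i)" for i
  proof -
    have "{p \<in> space (pm_measure x). R i p}
        = mball_of (pm_metric x) (c (fst (prod_decode i))) (1 / real (Suc (snd (prod_decode i))))"
      using cC by (auto simp: R_def pm_space_sets(2)[OF x])
    then show ?thesis
      using pm_open_sets[OF x openin_mball_of] by (simp add: pred_def)
  qed
  then obtain g :: "_ \<Rightarrow> real" and B where g: "g \<in> borel_measurable (pm_measure x)"
    and B [measurable]: "\<And>i. B i \<in> sets borel" and gB: "\<And>i p. g p \<in> B i \<longleftrightarrow> R i p"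
    using binary_code[of R "pm_measure x"] by metis
  \<comment> \<open>For a code \<open>r = g p\<close> this is the first centre within 1/(n+1) of
    \<open>p\<close>. For other \<open>r\<close> the \<open>LEAST\<close> may range over an empty
    set; the set \<open>G\<close> guards against this.\<close>
  define K where "K = (\<lambda>n r. LEAST k. r \<in> B (prod_encode (k, n)))"
  define s where "s = (\<lambda>n r. c (K n r))"
  have sC: "s n r \<in> pm_carrier x" for n r by (simp add: s_def cC)
  have K [measurable]: "K n \<in> borel \<rightarrow>\<^sub>M count_space UNIV" for n
    unfolding K_def by measurable
  \<comment> \<open>The inequality holds at every code of a point, by the triangle inequality
    through that point, and it forces the chosen centres to form a Cauchy sequence. \<open>G\<close>
    is Borel since the choices \<open>K n\<close> take countably many values.\<close>
  define G where "G = {r. \<forall>n m. pm_dist x (s n r) (s m r) < 1 / real (Suc n) + 1 / real (Suc m)}"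
  have G [measurable]: "G \<in> sets borel"
    unfolding G_def s_def by measurable
  have cauchy: "\<exists>l. limitin X.mtopology (\<lambda>n. s n r) l sequentially" if "r \<in> G" for r
  proof -
    have "X.MCauchy (\<lambda>n. s n r)"
      unfolding X.MCauchy_def
    proof (intro conjI allI impI)
      show "range (\<lambda>n. s n r) \<subseteq> pm_carrier x" using sC by auto
      fix e :: real assume "e > 0"
      then obtain N where N: "1 / real (Suc N) < e / 2"
        by (metis half_gt_zero nat_approx_posE)
      have "pm_dist x (s n r) (s m r) < e" if "N \<le> n" "N \<le> m" for n m
      proof -
        have "1 / real (Suc n) \<le> 1 / real (Suc N)" "1 / real (Suc m) \<le> 1 / real (Suc N)"
          using that by (auto intro!: divide_left_mono)
        moreover have "pm_dist x (s n r) (s m r) < 1 / real (Suc n) + 1 / real (Suc m)"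
          using \<open>r \<in> G\<close> by (simp add: G_def)
        ultimately show ?thesis using N by linarith
      qed
      then show "\<exists>N. \<forall>n n'. N \<le> n \<longrightarrow> N \<le> n' \<longrightarrow> pm_dist x (s n r) (s n' r) < e" by blast
    qed
    then show ?thesis using compl by (auto simp: X.mcomplete_def)
  qed
  \<comment> \<open>The default \<open>c 0\<close> keeps \<open>h\<close> inside the carrier off
    \<open>G\<close>.\<close>
  define h where "h = (\<lambda>r. if r \<in> G then SOME l. limitin X.mtopology (\<lambda>n. s n r) l sequentially else c 0)"
  have lim: "limitin X.mtopology (\<lambda>n. s n r) (h r) sequentially" if "r \<in> G" for r
    unfolding h_def using someI_ex[OF cauchy[OF that]] that by simp
  have hC: "h r \<in> pm_carrier x" for r
    using lim[of r] cC by (cases "r \<in> G") (auto simp: X.limitin_metric h_def)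
  have "h \<in> borel \<rightarrow>\<^sub>M pm_measure x"
  proof (rule measurable_pm_measureI[OF x hC])
    fix p assume p: "p \<in> pm_carrier x"
    show "(\<lambda>r. pm_dist x p (h r)) \<in> borel_measurable borel"
    \<comment> \<open>The distance to \<open>h r\<close> is the pointwise limit of the distances to
      the countably valued approximations, with the constant \<open>c 0\<close> used off
      \<open>G\<close>.\<close>
    proof (rule borel_measurable_LIMSEQ_real)
      show "(\<lambda>r. pm_dist x p (if r \<in> G then s n r else c 0)) \<in> borel_measurable borel" for n
        unfolding s_def by measurable
      fix r :: real
      show "(\<lambda>n. pm_dist x p (if r \<in> G then s n r else c 0)) \<longlonglongrightarrow> pm_dist x p (h r)"
      proof (cases "r \<in> G")
        case True
        have s_lim: "(\<lambda>n. pm_dist x (s n r) (h r)) \<longlonglongrightarrow> 0"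
          using lim[OF True] sC by (simp add: X.limitin_metric_dist_null)
        have "norm (pm_dist x p (s n r) - pm_dist x p (h r)) \<le> pm_dist x (s n r) (h r)" for n
          using X.triangle[OF p sC[of n r] hC[of r]] X.triangle[OF p hC[of r] sC[of n r]] X.commute[of "h r" "s n r"]
          by auto
        then have "\<forall>\<^sub>F n in sequentially. norm (pm_dist x p (s n r) - pm_dist x p (h r)) \<le> pm_dist x (s n r) (h r)"
          by simp
        from this s_lim have "(\<lambda>n. pm_dist x p (s n r) - pm_dist x p (h r)) \<longlonglongrightarrow> 0"
          by (rule Lim_null_comparison)
        then show ?thesis using True by (simp add: LIM_zero_iff)
      qed (simp add: h_def)
    qed
  qed
  moreover have "h (g p) = p" if p: "p \<in> pm_carrier x" for p
  proof -
    \<comment> \<open>Density makes the \<open>LEAST\<close> in \<open>K n (g p)\<close> range over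
      a nonempty set, so the chosen ball does contain \<open>p\<close>.\<close>
    have near: "pm_dist x (s n (g p)) p < 1 / real (Suc n)" for n
    proof -
      obtain k where "pm_dist x (c k) p < 1 / real (Suc n)"
        using dense[OF p, of "1 / real (Suc n)"] by auto
      then have "g p \<in> B (prod_encode (k, n))" by (simp add: gB R_def)
      then have "g p \<in> B (prod_encode (K n (g p), n))" unfolding K_def by (rule LeastI)
      then show ?thesis by (simp add: gB R_def s_def)
    qed
    have "pm_dist x (s n (g p)) (s m (g p)) < 1 / real (Suc n) + 1 / real (Suc m)" for n m
      using X.triangle[OF sC[of n "g p"] p sC[of m "g p"]] near[of n] near[of m] X.commute[of "s m (g p)" p] by linarith
    then have gG: "g p \<in> G" by (simp add: G_def)
    have "(\<lambda>n. pm_dist x (s n (g p)) p) \<longlonglongrightarrow> 0"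
    proof (rule Lim_null_comparison)
      show "(\<lambda>n. 1 / real (Suc n)) \<longlonglongrightarrow> 0"
        using LIMSEQ_inverse_real_of_nat by (simp add: inverse_eq_divide)
      show "\<forall>\<^sub>F n in sequentially. norm (pm_dist x (s n (g p)) p) \<le> 1 / real (Suc n)"
        using near by (intro always_eventually) (auto intro: less_imp_le simp del: of_nat_Suc)
    qed
    then have "limitin X.mtopology (\<lambda>n. s n (g p)) p sequentially"
      using p sC by (simp add: X.limitin_metric_dist_null)
    then show ?thesis
      using X.limitin_metric_unique[OF lim[OF gG]] by simp
  qed
  ultimately show ?thesis using that[of g h] g by blast
qed

text \<open>If \<open>q\<close> is a quantile parameter of the image of the measure under the code
  \<open>g\<close>, then \<open>h \<circ> q\<close> has the law of \<open>h \<circ> g\<close>, which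
  is the identity on the carrier.\<close>

lemma pm_parameter_exists:
  assumes x: "pm_space x"
  shows "\<exists>a. pm_parameter x a"
proof -
  interpret prob_space "pm_measure x" using x by (simp add: pm_space_def)
  obtain g h where g: "g \<in> pm_measure x \<rightarrow>\<^sub>M (borel :: real measure)"
    and h: "h \<in> borel \<rightarrow>\<^sub>M pm_measure x" and hg: "\<And>p. p \<in> pm_carrier x \<Longrightarrow> h (g p) = p"
    by (rule pm_space_real_embedding[OF x]) (rule that)
  let ?N = "distr (pm_measure x) borel g"
  have "real_distribution ?N"
    using g by (simp add: real_distribution_def real_distribution_axioms_def prob_space_distr)
  then obtain q where q: "q \<in> unit_interval \<rightarrow>\<^sub>M ?N" "distr unit_interval ?N q = ?N"
    by (rule unit_interval_distr_real)
  have q': "q \<in> borel_measurable unit_interval" "distr unit_interval borel q = ?N"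
    using q by (auto cong: distr_cong)
  have "distr unit_interval (pm_measure x) (h \<circ> q) = distr (pm_measure x) (pm_measure x) (h \<circ> g)"
    by (simp only: distr_distr[OF h q'(1), symmetric] distr_distr[OF h g, symmetric] q'(2))
  also have "\<dots> = distr (pm_measure x) (pm_measure x) (\<lambda>p. p)"
    by (rule distr_cong) (auto simp: hg pm_space_sets(2)[OF x])
  finally have "distr unit_interval (pm_measure x) (h \<circ> q) = pm_measure x"
    by (simp add: distr_id)
  moreover have "h \<circ> q \<in> unit_interval \<rightarrow>\<^sub>M pm_measure x"
    using q'(1) h by (rule measurable_comp)
  ultimately show ?thesis unfolding pm_parameter_def by blast
qed

section \<open>Scaling and the Lipschitz order\<close>

lemma full_pm_space_scale: "t > 0 \<Longrightarrow> full_pm_space x \<Longrightarrow> full_pm_space (pm_scale t x)"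
  by (simp add: full_pm_space_def pm_space_scale pm_scale_simps)

lemma pm_scale_scale:
  assumes "s > 0" "t > 0"
  shows "pm_scale s (pm_scale t x) = pm_scale (s * t) x"
  unfolding pm_scale_def[of s] pm_scale_def[of "s * t"]
  using assms by (simp add: pm_scale_simps mult.assoc)

lemma pm_scale_1: "pm_scale 1 x = x"
  unfolding pm_scale_def by simp

lemma scale_scale:
  assumes "s > 0" "t > 0"
  shows "scale s (scale t X) = scale (s * t) X"
  using assms repr(1)[of X]
  by (simp add: scale_def[of t] scale_def[of "s * t"] scale_abs full_pm_space_scale pm_scale_scale)

lemma scale_1: "scale 1 X = X"
  by (simp add: scale_def pm_scale_1 repr)

text \<open>Scaling by \<open>1 / t\<close> inverts scaling by \<open>t\<close>. Membership in a
  scaled set thereby becomes a preimage condition, which suits the topological arguments.\<close>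

lemma mem_scale_set:
  assumes "t > 0"
  shows "X \<in> scale_set t A \<longleftrightarrow> scale (1 / t) X \<in> A"
proof
  assume "scale (1 / t) X \<in> A"
  then have "scale t (scale (1 / t) X) \<in> scale_set t A" by (simp add: scale_set_def)
  then show "X \<in> scale_set t A" using assms by (simp add: scale_scale scale_1)
qed (use assms in \<open>auto simp: scale_set_def scale_scale scale_1\<close>)

lemma lip_le_scale:
  assumes t: "t > 0" and "lip_le X Y"
  shows "lip_le (scale t X) (scale t Y)"
proof -
  have "pm_dominated (pm_scale t (repr X)) (pm_scale t (repr Y))"
    using assms unfolding lip_le_def pm_dominated_def by (simp add: pm_scale_simps)
  then show ?thesis
    unfolding scale_def by (simp add: lip_le_abs full_pm_space_scale repr t)
qed

text \<open>The identity map is 1-Lipschitz from the larger metric to the smaller one, and the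
  measure is the same.\<close>

lemma lip_le_scale_mono:
  assumes "0 < s" "s \<le> t"
  shows "lip_le (scale s X) (scale t X)"
proof -
  have "pm_dominated (pm_scale s (repr X)) (pm_scale t (repr X))"
    unfolding pm_dominated_def
  proof (intro exI[of _ "\<lambda>p. p"] conjI ballI)
    fix p q
    show "pm_dist (pm_scale s (repr X)) p q \<le> pm_dist (pm_scale t (repr X)) p q"
      using assms by (simp add: pm_scale_simps mult_right_mono)
  qed (use assms in \<open>simp_all add: pm_scale_simps distr_id\<close>)
  then show ?thesis
    using assms unfolding scale_def by (simp add: lip_le_abs full_pm_space_scale repr)
qed

section \<open>Box distance and scaling\<close>

lemma pm_parameter_scale: "t > 0 \<Longrightarrow> pm_parameter (pm_scale t x) a \<longleftrightarrow> pm_parameter x a"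
  by (simp add: pm_parameter_def pm_scale_simps)

lemma pm_box_less:
  assumes "\<epsilon> > 0" "pm_box_bound x y \<epsilon>" "\<epsilon> < r"
  shows "pm_box x y < r"
proof -
  have "pm_box x y \<le> \<epsilon>"
    unfolding pm_box_def using assms by (intro cInf_lower) (auto intro: bdd_belowI[of _ 0])
  with assms show ?thesis by simp
qed

text \<open>Since parameters exist, the bound 1 is admissible with the empty exceptional-free set
  \<open>{}\<close>; hence the infimum runs over a nonempty set and is approximated by admissible
  values.\<close>

lemma pm_box_lessE:
  assumes x: "pm_space x" and y: "pm_space y" and "pm_box x y < r"
  obtains \<epsilon> where "\<epsilon> > 0" "pm_box_bound x y \<epsilon>" "\<epsilon> < r"
proof -
  obtain a b where "pm_parameter x a" "pm_parameter y b"
    using pm_parameter_exists[OF x] pm_parameter_exists[OF y] by blast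
  then have "pm_box_bound x y 1"
    unfolding pm_box_bound_def by (intro exI[of _ a] exI[of _ b] exI[of _ "{}"]) simp
  then have "{\<epsilon>. \<epsilon> > 0 \<and> pm_box_bound x y \<epsilon>} \<noteq> {}"
    using zero_less_one by blast
  from cInf_lessD[OF this] assms(3) that show ?thesis by (auto simp: pm_box_def)
qed

text \<open>The same parameters and the same set serve for the scaled spaces. Distance defects are
  multiplied by \<open>t\<close>, while the measure defect stays fixed and so requires a factor of
  at least 1; hence \<open>max 1 t\<close>.\<close>

lemma box_dist_scale_less:
  assumes t: "t > 0" and "box_dist X Y < r"
  shows "box_dist (scale t X) (scale t Y) < max 1 t * r"
proof -
  let ?x = "repr X" and ?y = "repr Y"
  obtain \<epsilon> where e: "\<epsilon> > 0" "pm_box_bound ?x ?y \<epsilon>" "\<epsilon> < r"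
    using assms(2) unfolding box_dist_def
    by (rule pm_box_lessE[rotated 2]) (use repr(1) in \<open>auto simp: full_pm_space_def\<close>)
  obtain a b I where I: "pm_parameter ?x a" "pm_parameter ?y b"
    "I \<in> sets borel" "I \<subseteq> {0..1}" "measure lborel I \<ge> 1 - \<epsilon>"
    "\<forall>s\<in>I. \<forall>t\<in>I. \<bar>pm_dist ?x (a s) (a t) - pm_dist ?y (b s) (b t)\<bar> \<le> \<epsilon>"
    using e(2) unfolding pm_box_bound_def by blast
  have le: "\<epsilon> \<le> max 1 t * \<epsilon>" using e(1) by simp
  have "\<bar>t * pm_dist ?x (a u) (a v) - t * pm_dist ?y (b u) (b v)\<bar> \<le> max 1 t * \<epsilon>"
    if "u \<in> I" "v \<in> I" for u v
  proof -
    have "\<bar>t * pm_dist ?x (a u) (a v) - t * pm_dist ?y (b u) (b v)\<bar>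
        = t * \<bar>pm_dist ?x (a u) (a v) - pm_dist ?y (b u) (b v)\<bar>"
      using t by (simp add: abs_mult flip: right_diff_distrib)
    also have "\<dots> \<le> max 1 t * \<epsilon>" using I(6) that t by (intro mult_mono) auto
    finally show ?thesis .
  qed
  then have "pm_box_bound (pm_scale t ?x) (pm_scale t ?y) (max 1 t * \<epsilon>)"
    unfolding pm_box_bound_def using I le t
    by (intro exI[of _ a] exI[of _ b] exI[of _ I]) (auto simp: pm_parameter_scale pm_scale_simps)
  then have "pm_box (pm_scale t ?x) (pm_scale t ?y) < max 1 t * r"
    by (rule pm_box_less[rotated]) (use e in \<open>simp_all add: mult_strict_left_mono\<close>)
  then show ?thesis
    unfolding scale_def using t repr(1) by (simp add: box_dist_abs full_pm_space_scale)
qed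

text \<open>A measure is concentrated, up to \<open>\<epsilon>\<close>, on a ball, where rescaling changes distances only
  slightly.\<close>

lemma box_dist_scale_small:
  assumes e: "\<epsilon> > 0"
  obtains \<delta> where "\<delta> > 0" "\<And>t. t > 0 \<Longrightarrow> \<bar>t - 1\<bar> \<le> \<delta> \<Longrightarrow> box_dist X (scale t X) < \<epsilon>"
proof -
  let ?x = "repr X"
  have x: "pm_space ?x" using repr(1) by (simp add: full_pm_space_def)
  interpret X: Metric_space "pm_carrier ?x" "pm_dist ?x" by simp
  obtain a where a: "pm_parameter ?x a" using pm_parameter_exists[OF x] by blast
  have aC: "a s \<in> pm_carrier ?x" if "s \<in> {0..1}" for s
    using a that measurable_space[of a unit_interval "pm_measure ?x" s]
    by (auto simp: pm_parameter_def pm_space_sets[OF x])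
  let ?p = "a 0"
  define I where "I = (\<lambda>n. {s \<in> {0..1}. pm_dist ?x ?p (a s) < real n})"
  have I_sets: "I n \<in> sets lborel" for n
  proof -
    have "a -` mball_of (pm_metric ?x) ?p (real n) \<inter> space unit_interval \<in> sets unit_interval"
      using a pm_open_sets[OF x openin_mball_of]
      unfolding pm_parameter_def by (intro measurable_sets) auto
    moreover have "a -` mball_of (pm_metric ?x) ?p (real n) \<inter> space unit_interval = I n"
      using aC by (auto simp: I_def)
    ultimately show ?thesis by (simp add: sets_restrict_space_iff)
  qed
  \<comment> \<open>The sets \<open>I n\<close> increase to the unit interval, so continuity from
    below makes one of them have measure above \<open>1 - \<epsilon> / 2\<close>.\<close>
  have "(\<lambda>n. measure lborel (I n)) \<longlonglongrightarrow> measure lborel (\<Union>n. I n)"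
  proof (rule Lim_measure_incseq)
    show "incseq I" unfolding I_def incseq_def by (auto intro: less_le_trans)
    have "(\<Union>n. I n) \<subseteq> {0..1}" by (auto simp: I_def)
    then have "emeasure lborel (\<Union>n. I n) \<le> emeasure lborel {0..1::real}"
      by (rule emeasure_mono) simp
    then show "emeasure lborel (\<Union>n. I n) \<noteq> \<infinity>" by (auto simp: top_unique)
  qed (use I_sets in auto)
  moreover have "(\<Union>n. I n) = {0..1}" by (auto simp: I_def reals_Archimedean2)
  ultimately have "(\<lambda>n. measure lborel (I n)) \<longlonglongrightarrow> 1" by simp
  then have "\<forall>\<^sub>F n in sequentially. measure lborel (I n) > 1 - \<epsilon> / 2"
    by (rule order_tendstoD) (use e in simp)
  then obtain n where n: "measure lborel (I n) > 1 - \<epsilon> / 2"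
    by (auto simp: eventually_sequentially)
  \<comment> \<open>On \<open>I n\<close> mutual distances are at most
    \<open>2 * real n + 1\<close>, so a relative change of at most \<open>\<delta>\<close> alters
    them by at most \<open>\<epsilon> / 2\<close>. The added 1 keeps the denominator positive for
    \<open>n = 0\<close>; halving \<open>\<epsilon>\<close> yields the strict inequality.\<close>
  define \<delta> where "\<delta> = \<epsilon> / (2 * (2 * real n + 1))"
  have d: "\<delta> > 0" using e by (simp add: \<delta>_def)
  have "box_dist X (scale t X) < \<epsilon>" if t: "t > 0" "\<bar>t - 1\<bar> \<le> \<delta>" for t
  proof -
    have "\<bar>pm_dist ?x (a u) (a v) - t * pm_dist ?x (a u) (a v)\<bar> \<le> \<epsilon> / 2"
      if "u \<in> I n" "v \<in> I n" for u v
    proof -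
      have "pm_dist ?x (a u) (a v) \<le> pm_dist ?x (a u) ?p + pm_dist ?x ?p (a v)"
        using that aC by (intro X.triangle) (auto simp: I_def)
      then have "pm_dist ?x (a u) (a v) \<le> 2 * real n + 1"
        using that X.commute[of "a u" ?p] by (auto simp: I_def)
      moreover have "\<bar>pm_dist ?x (a u) (a v) - t * pm_dist ?x (a u) (a v)\<bar>
          = \<bar>(t - 1) * pm_dist ?x (a u) (a v)\<bar>"
        by (simp add: left_diff_distrib abs_minus_commute)
      ultimately have "\<bar>pm_dist ?x (a u) (a v) - t * pm_dist ?x (a u) (a v)\<bar> \<le> \<delta> * (2 * real n + 1)"
        using t d by (simp add: abs_mult mult_mono)
      also have "\<dots> = \<epsilon> / 2" unfolding \<delta>_def by (simp add: field_simps)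
      finally show ?thesis .
    qed
    then have "pm_box_bound ?x (pm_scale t ?x) (\<epsilon> / 2)"
      unfolding pm_box_bound_def using a n t I_sets[of n]
      by (intro exI[of _ a] exI[of _ "I n"])
        (auto simp: pm_parameter_scale pm_scale_simps I_def)
    then have "pm_box ?x (pm_scale t ?x) < \<epsilon>"
      by (rule pm_box_less[rotated]) (use e in auto)
    then show ?thesis
      using box_dist_abs[OF repr(1) full_pm_space_scale[OF t(1) repr(1)], of X X]
      by (simp add: scale_def repr)
  qed
  with d that show ?thesis by blast
qed

text \<open>Scaling is continuous, as it enlarges box distances by a factor of at most
  \<open>max 1 t\<close>.\<close>

lemma openin_box_scale_vimage:
  assumes t: "t > 0" and U: "openin box_topology U"
  shows "openin box_topology {X. scale t X \<in> U}"
  unfolding openin_box_topology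
proof (intro ballI)
  fix X assume "X \<in> {X. scale t X \<in> U}"
  then obtain r where r: "r > 0" "\<And>Y. box_dist (scale t X) Y < r \<Longrightarrow> Y \<in> U"
    using U unfolding openin_box_topology by blast
  show "\<exists>r>0. \<forall>Y. box_dist X Y < r \<longrightarrow> Y \<in> {X. scale t X \<in> U}"
  proof (intro exI[of _ "r / max 1 t"] conjI allI impI CollectI)
    fix Y assume "box_dist X Y < r / max 1 t"
    from box_dist_scale_less[OF t this] show "scale t Y \<in> U" by (intro r(2)) simp
  qed (use r(1) in simp)
qed

lemma closedin_box_complement: "closedin box_topology A \<longleftrightarrow> openin box_topology (- A)"
  by (simp add: closedin_def topspace_box_topology Compl_eq_Diff_UNIV)

section \<open>From closed downward-closed sets to functionals\<close>

lemma functional_of_eq: "functional_of A X = Inf (ennreal ` {t. t > 0 \<and> scale (1 / t) X \<in> A})"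
  unfolding functional_of_def by (intro arg_cong[where f = Inf]) (auto simp: mem_scale_set)

text \<open>Downward-closedness makes the admissible \<open>t\<close> an up-set: if \<open>t\<close>
  exceeds an admissible \<open>s\<close>, then the space scaled by \<open>1 / t\<close> lies below
  the one scaled by \<open>1 / s\<close>. The strict \<open>t > c\<close> leaves open whether the
  infimum is attained.\<close>

lemma functional_of_le_iff:
  assumes A: "downward_closed A" and c: "c \<ge> 0"
  shows "functional_of A X \<le> ennreal c \<longleftrightarrow> (\<forall>t>c. scale (1 / t) X \<in> A)"
proof
  assume le: "functional_of A X \<le> ennreal c"
  show "\<forall>t>c. scale (1 / t) X \<in> A"
  proof (intro allI impI)
    fix t assume "c < t"
    then have "functional_of A X < ennreal t" using le c by (simp add: ennreal_lessI le_less_trans)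
    then obtain s where s: "s > 0" "scale (1 / s) X \<in> A" "ennreal s < ennreal t"
      unfolding functional_of_eq Inf_less_iff by auto
    then have "s < t" using \<open>c < t\<close> c by (simp add: ennreal_less_iff)
    with s have "lip_le (scale (1 / t) X) (scale (1 / s) X)"
      by (intro lip_le_scale_mono) (auto intro!: divide_left_mono)
    then show "scale (1 / t) X \<in> A" using A s(2) unfolding downward_closed_def by blast
  qed
next
  assume r: "\<forall>t>c. scale (1 / t) X \<in> A"
  show "functional_of A X \<le> ennreal c"
  proof (rule ennreal_le_epsilon)
    fix e :: real assume "e > 0"
    then show "functional_of A X \<le> ennreal c + ennreal e"
      using r c unfolding functional_of_eq ennreal_plus[symmetric, OF c less_imp_le[OF \<open>e > 0\<close>]]
      by (intro Inf_lower imageI) auto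
  qed
qed

text \<open>Closedness supplies attainment at 1: if all shrunken copies of \<open>X\<close> lie in
  \<open>A\<close>, so does \<open>X\<close>, their limit as the factor tends to 1.\<close>

lemma functional_of_le_1_iff:
  assumes A: "downward_closed A" "closedin box_topology A"
  shows "functional_of A X \<le> 1 \<longleftrightarrow> X \<in> A"
proof -
  have "X \<in> A" if *: "\<forall>t>1. scale (1 / t) X \<in> A"
  proof (rule ccontr)
    assume "X \<notin> A"
    then obtain r where r: "r > 0" "\<And>Y. box_dist X Y < r \<Longrightarrow> Y \<notin> A"
      using A(2) unfolding closedin_box_complement openin_box_topology by blast
    obtain \<delta> where d: "\<delta> > 0" "\<And>t. t > 0 \<Longrightarrow> \<bar>t - 1\<bar> \<le> \<delta> \<Longrightarrow> box_dist X (scale t X) < r"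
      by (rule box_dist_scale_small[OF r(1)]) (rule that)
    \<comment> \<open>The factor belongs to \<open>t = 1 + \<delta>\<close>; it puts a point of
      \<open>A\<close> into the ball about \<open>X\<close> that avoids \<open>A\<close>.\<close>
    have "\<bar>1 / (1 + \<delta>) - 1\<bar> \<le> \<delta>"
      using d(1) by (simp add: abs_if field_simps)
    then show False using r(2)[OF d(2)[of "1 / (1 + \<delta>)"]] * d(1) by auto
  qed
  moreover have "scale (1 / t) X \<in> A" if "X \<in> A" "t > 1" for t
    using that A(1) lip_le_scale_mono[of "1 / t" 1 X] unfolding downward_closed_def scale_1 by auto
  ultimately show ?thesis
    using functional_of_le_iff[OF A(1), of 1 X] by auto
qed

text \<open>Multiplication by a positive finite \<open>t\<close> is an order automorphism of
  \<open>ennreal\<close>, with inverse multiplication by \<open>1 / t\<close>.\<close>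

lemma ennreal_Inf_cmult:
  assumes t: "t > 0"
  shows "Inf ((\<lambda>u. ennreal t * u) ` S) = ennreal t * Inf S"
proof (rule antisym)
  let ?I = "Inf ((\<lambda>u. ennreal t * u) ` S)"
  have inv: "ennreal t * (ennreal (1 / t) * u) = u" "ennreal (1 / t) * (ennreal t * u) = u" for u
    using t by (simp_all add: mult.assoc[symmetric] flip: ennreal_mult)
  have "ennreal (1 / t) * ?I \<le> Inf S"
  proof (rule Inf_greatest)
    fix s assume "s \<in> S"
    then have "ennreal (1 / t) * ?I \<le> ennreal (1 / t) * (ennreal t * s)"
      by (intro mult_left_mono Inf_lower) auto
    then show "ennreal (1 / t) * ?I \<le> s" by (simp only: inv)
  qed
  then have "ennreal t * (ennreal (1 / t) * ?I) \<le> ennreal t * Inf S"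
    by (rule mult_left_mono) simp
  then show "?I \<le> ennreal t * Inf S" by (simp only: inv)
  show "ennreal t * Inf S \<le> ?I"
    by (auto intro!: INF_greatest mult_left_mono Inf_lower)
qed

lemma functional_of_functionals:
  assumes A: "A \<in> closed_down_sets"
  shows "functional_of A \<in> functionals"
proof -
  have dc: "downward_closed A" and cl: "closedin box_topology A"
    using A by (auto simp: closed_down_sets_def)
  have "homogeneous (functional_of A)"
    unfolding homogeneous_def
  proof (intro allI impI)
    fix t :: real and X assume t: "t > 0"
    let ?S = "{u. u > 0 \<and> scale (1 / u) X \<in> A}"
    \<comment> \<open>Homogeneity is the substitution \<open>u = t * v\<close> in the set of
      admissible factors.\<close>
    have "{u. u > 0 \<and> scale (1 / u) (scale t X) \<in> A} = (\<lambda>u. t * u) ` ?S"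
    proof (intro equalityI subsetI)
      fix u assume "u \<in> {u. u > 0 \<and> scale (1 / u) (scale t X) \<in> A}"
      then have "u / t \<in> ?S" using t by (auto simp: scale_scale)
      then have "t * (u / t) \<in> (\<lambda>u. t * u) ` ?S" by (rule imageI)
      then show "u \<in> (\<lambda>u. t * u) ` ?S" using t by simp
    qed (use t in \<open>auto simp: scale_scale\<close>)
    then have "functional_of A (scale t X) = Inf ((\<lambda>u. ennreal t * u) ` ennreal ` ?S)"
      using t by (simp add: functional_of_eq image_image ennreal_mult'')
    also have "\<dots> = ennreal t * functional_of A X"
      unfolding functional_of_eq by (rule ennreal_Inf_cmult[OF t])
    finally show "functional_of A (scale t X) = ennreal t * functional_of A X" .
  qed
  moreover have "lip_monotone (functional_of A)"
    unfolding lip_monotone_def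
  proof (intro allI impI)
    fix X Y assume "lip_le X Y"
    then have "scale (1 / t) X \<in> A" if "t > 0" "scale (1 / t) Y \<in> A" for t
      using that dc lip_le_scale[of "1 / t" X Y] unfolding downward_closed_def by auto
    then show "functional_of A X \<le> functional_of A Y"
      unfolding functional_of_eq by (intro Inf_superset_mono) auto
  qed
  moreover have "box_lsc (functional_of A)"
    unfolding box_lsc_def
  proof
    fix c :: ennreal
    show "openin box_topology {X. c < functional_of A X}"
    proof (cases c)
      case (real c')
      \<comment> \<open>The value exceeds \<open>c\<close> exactly when some \<open>t > c'\<close>
        fails to be admissible. This exhibits the set as a union of preimages of the open complement
        of \<open>A\<close> under continuous scalings.\<close>
      have "{X. c < functional_of A X} = (\<Union>t\<in>{c'<..}. {X. scale (1 / t) X \<in> - A})"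
        using functional_of_le_iff[OF dc real(1)] unfolding real(2) by (auto simp: not_le[symmetric])
      moreover have "openin box_topology {X. scale (1 / t) X \<in> - A}" if "t > c'" for t
        using cl real(1) that by (intro openin_box_scale_vimage) (auto simp: closedin_box_complement)
      ultimately show ?thesis by (auto intro!: openin_Union)
    qed simp
  qed
  ultimately show ?thesis by (simp add: functionals_def)
qed

section \<open>From functionals to sublevel sets, and the bijection\<close>

lemma sublevel_closed_down_sets:
  assumes F: "F \<in> functionals"
  shows "{X. F X \<le> 1} \<in> closed_down_sets" "functional_of {X. F X \<le> 1} = F"
proof -
  have hom: "\<And>t X. t > 0 \<Longrightarrow> F (scale t X) = ennreal t * F X" and mono: "\<And>X Y. lip_le X Y \<Longrightarrow> F X \<le> F Y"
    and lsc: "\<And>c. openin box_topology {X. c < F X}"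
    using F by (auto simp: functionals_def homogeneous_def lip_monotone_def box_lsc_def)
  have dc: "downward_closed {X. F X \<le> 1}"
    unfolding downward_closed_def using mono order_trans by blast
  moreover have "closedin box_topology {X. F X \<le> 1}"
    using lsc[of 1] unfolding closedin_box_complement by (simp add: Compl_eq not_le)
  ultimately show "{X. F X \<le> 1} \<in> closed_down_sets"
    by (simp add: closed_down_sets_def)
  \<comment> \<open>Homogeneity turns the level 1 into any level \<open>t\<close>, so the unit
    sublevel set determines all others.\<close>
  have sc: "F (scale (1 / t) X) \<le> 1 \<longleftrightarrow> F X \<le> ennreal t" if "t > 0" for t X
  proof -
    have "F (scale (1 / t) X) \<le> 1 \<longleftrightarrow> ennreal t * F (scale (1 / t) X) \<le> ennreal t * 1"
      using that ennreal_mult_le_mult_iff[of "ennreal t" "F (scale (1 / t) X)" 1] by simp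
    also have "ennreal t * F (scale (1 / t) X) = F (scale t (scale (1 / t) X))"
      using that by (simp add: hom)
    finally show ?thesis using that by (simp add: scale_scale scale_1)
  qed
  have "functional_of {X. F X \<le> 1} X \<le> ennreal c \<longleftrightarrow> F X \<le> ennreal c" if c: "c \<ge> 0" for X c
  proof -
    have "functional_of {X. F X \<le> 1} X \<le> ennreal c \<longleftrightarrow> (\<forall>t>c. F X \<le> ennreal t)"
      using functional_of_le_iff[OF dc c, of X] c sc by auto
    also have "\<dots> \<longleftrightarrow> F X \<le> ennreal c"
    proof
      assume *: "\<forall>t>c. F X \<le> ennreal t"
      show "F X \<le> ennreal c"
      proof (rule ennreal_le_epsilon)
        fix e :: real assume "e > 0"
        then show "F X \<le> ennreal c + ennreal e" using * c by (simp flip: ennreal_plus)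
      qed
    qed (use c in \<open>auto intro: order_trans ennreal_leI\<close>)
    finally show ?thesis .
  qed
  \<comment> \<open>Two values in \<open>ennreal\<close> with the same finite upper bounds agree; if
    there are none, both are infinite.\<close>
  then have "functional_of {X. F X \<le> 1} X = F X" for X
    by (metis ennreal_cases enn2real_nonneg order.antisym order_refl top_greatest)
  then show "functional_of {X. F X \<le> 1} = F" by blast
qed

theorem theorem3p8:
  shows "(\<forall>A\<in>closed_down_sets. functional_of A \<in> functionals) \<and>
         bij_betw functional_of closed_down_sets functionals"
proof
  show "\<forall>A\<in>closed_down_sets. functional_of A \<in> functionals"
    using functional_of_functionals by blast
  show "bij_betw functional_of closed_down_sets functionals"
  proof (rule bij_betwI[where g = "\<lambda>F. {X. F X \<le> 1}"])
    show "{X. functional_of A X \<le> 1} = A" if "A \<in> closed_down_sets" for A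
      using that functional_of_le_1_iff by (auto simp: closed_down_sets_def)
  qed (use functional_of_functionals sublevel_closed_down_sets in auto)
qed

end
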